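(* Let $\sigma\in\mathcal C$. The quadratic form $q_\sigma(\psi)=\int_{\mathbb R^n}|\widehat\psi(u)|^2\,d\sigma(u)$, $\psi\in\mathcal S_{\mathbb R^n}$, is closable (in $\mathbf L_2(\mathbb R^n,dx)$) if and only if $\sigma$ is absolutely continuous with respect to the Lebesgue measure on $\mathbb R^n$.
   Context: $\mathcal S_{\mathbb R^n}$ is the space of complex-valued Schwartz functions on $\mathbb R^n$, and $\widehat\psi(u)=\int_{\mathbb R^n}e^{-iu\cdot x}\psi(x)\,dx$. $\mathcal C$ is the set of positive regular Borel measures $\sigma$ on $\mathbb R^n$ such that $\int_{\mathbb R^n}\frac{d\sigma(u)}{(1+|u|^2)^p}<\infty$ for some $p\in\mathbb N$. A quadratic form $q$ defined on $\mathcal S_{\mathbb R^n}$ is called closable if for every sequence $(s_k)_{k\in\mathbb N}$ in $\mathcal S_{\mathbb R^n}$ with $\lim_{k\to\infty}\|s_k\|_{\mathbf L_2(\mathbb R^n,dx)}=0$ and $\lim_{k,\ell\to\infty}q(s_k-s_\ell)=0$, it holds that $\lim_{k\to\infty}q(s_k)=0$. *)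

theory Defs
  imports "HOL-Analysis.Analysis"
begin

definition partial_deriv ::
    "'n \<Rightarrow> (real ^ 'n::finite \<Rightarrow> complex) \<Rightarrow> real ^ 'n \<Rightarrow> complex" where
  "partial_deriv i f x = frechet_derivative f (at x) (axis i 1)"

text \<open>
  Iterated partial derivatives are indexed by lists of coordinates, rather than by multi-indices,
  so that no order of differentiation has to be chosen.
\<close>

definition iter_partial_deriv ::
    "'n list \<Rightarrow> (real ^ 'n::finite \<Rightarrow> complex) \<Rightarrow> real ^ 'n \<Rightarrow> complex" where
  "iter_partial_deriv is f = foldr partial_deriv is f"

text \<open>
  Differentiability of every iterated partial derivative at every point is smoothness of \<open>f\<close>, and
  it makes every \<open>frechet_derivative\<close> occurring in \<open>iter_partial_deriv\<close> a genuine derivative.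
\<close>

definition smooth :: "(real ^ 'n::finite \<Rightarrow> complex) \<Rightarrow> bool" where
  "smooth f \<longleftrightarrow> (\<forall>is x. iter_partial_deriv is f differentiable (at x))"

definition schwartz_space :: "(real ^ 'n::finite \<Rightarrow> complex) set" where
  "schwartz_space =
    {f. smooth f \<and>
        (\<forall>(\<alpha> :: 'n \<Rightarrow> nat) is.
           bounded (range (\<lambda>x. complex_of_real (\<Prod>i\<in>UNIV. (x $ i) ^ \<alpha> i)
                               * iter_partial_deriv is f x)))}"

definition fourier :: "(real ^ 'n::finite \<Rightarrow> complex) \<Rightarrow> real ^ 'n \<Rightarrow> complex" where
  "fourier \<psi> u = (LINT x|lborel. exp (- (\<i> * complex_of_real (u \<bullet> x))) * \<psi> x)"

definition L2_norm :: "(real ^ 'n::finite \<Rightarrow> complex) \<Rightarrow> real" where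
  "L2_norm \<psi> = sqrt (LINT x|lborel. (norm (\<psi> x))\<^sup>2)"

definition regular_borel_measure :: "'a::topological_space measure \<Rightarrow> bool" where
  "regular_borel_measure \<sigma> \<longleftrightarrow>
     sets \<sigma> = sets borel \<and>
     (\<forall>A\<in>sets borel.
        emeasure \<sigma> A = (INF U\<in>{U. open U \<and> A \<subseteq> U}. emeasure \<sigma> U) \<and>
        emeasure \<sigma> A = (SUP K\<in>{K. compact K \<and> K \<subseteq> A}. emeasure \<sigma> K))"

definition tempered_measures :: "(real ^ 'n::finite) measure set" where
  "tempered_measures =
    {\<sigma>. regular_borel_measure \<sigma> \<and>
        (\<exists>p::nat. (\<integral>\<^sup>+u. ennreal (1 / (1 + (norm u)\<^sup>2) ^ p) \<partial>\<sigma>) < \<infinity>)}"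

text \<open>
  For \<open>\<sigma>\<close> in \<open>tempered_measures\<close> and \<open>\<psi>\<close> in \<open>schwartz_space\<close> the integrand below is
  \<open>\<sigma>\<close>-integrable, because \<open>fourier \<psi>\<close> decays rapidly; the value 0 that the Bochner integral assigns
  to non-integrable functions is therefore never used.
\<close>

definition spectral_form ::
    "(real ^ 'n::finite) measure \<Rightarrow> (real ^ 'n \<Rightarrow> complex) \<Rightarrow> real" where
  "spectral_form \<sigma> \<psi> = (LINT u|\<sigma>. (norm (fourier \<psi> u))\<^sup>2)"

definition closable :: "((real ^ 'n::finite \<Rightarrow> complex) \<Rightarrow> real) \<Rightarrow> bool" where
  "closable q \<longleftrightarrow>
    (\<forall>s :: nat \<Rightarrow> real ^ 'n \<Rightarrow> complex.
       (\<forall>k. s k \<in> schwartz_space) \<longrightarrow>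
       (\<lambda>k. L2_norm (s k)) \<longlonglongrightarrow> 0 \<longrightarrow>
       ((\<lambda>(k, l). q (\<lambda>x. s k x - s l x)) \<longlongrightarrow> 0) (sequentially \<times>\<^sub>F sequentially) \<longrightarrow>
       (\<lambda>k. q (s k)) \<longlonglongrightarrow> 0)"

end

theory Submission
  imports Defs
begin

text \<open>
  Write \<open>F\<close> for the Fourier transform. The form is the squared norm of \<open>F \<psi>\<close> in \<open>L\<^sub>2(\<sigma>)\<close>, while the
  norm of \<open>\<psi>\<close> in \<open>L\<^sub>2(dx)\<close> is, up to a constant, that of \<open>F \<psi>\<close> in \<open>L\<^sub>2(du)\<close>. Closability thus asks whether
  a sequence \<open>F s\<^sub>k\<close> that tends to 0 for Lebesgue measure and is Cauchy for \<open>\<sigma>\<close> also tends to 0 for \<open>\<sigma>\<close>.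
  If \<open>\<sigma>\<close> is absolutely continuous, this holds: a subsequence tends to 0 almost everywhere for Lebesgue
  measure, hence \<open>\<sigma>\<close>-almost everywhere, and Fatou's lemma transfers the Cauchy condition into
  convergence (\<open>closable_if_absolutely_continuous\<close>). If \<open>\<sigma>\<close> is not absolutely continuous, regularity gives a compact Lebesgue null set \<open>K\<close> with
  \<open>\<sigma> K > 0\<close>. Cutoff functions shrinking to the indicator of \<open>K\<close> tend to 0 for Lebesgue measure, but
  to the indicator, which is not 0, for \<open>\<sigma>\<close> (\<open>not_closable_if_charges_null_compact\<close>).

  Two analytic facts are needed. First, \<open>F \<psi>\<close> decays rapidly for Schwartz \<open>\<psi>\<close>, so that the form is
  finite (\<open>fourier_schwartz_rapidly_decreasing\<close>). Second, the norms have to be compared. The full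
  theorem of Plancherel is avoided by inserting a Gaussian weight: expanding
  \<open>|F f|\<^sup>2 gaussian (\<epsilon> u)\<close> leads to a positive convolution kernel whose mass does not depend on \<open>\<epsilon>\<close>, and
  Schur's test gives the inequality \<open>fourier_bessel\<close>. The weight \<open>\<epsilon> = 1\<close> suffices for almost everywhere
  convergence of a subsequence.

  For the converse direction, Schwartz functions with prescribed Fourier transform are required. Fourier
  inversion is likewise regularised: the inverse transform of a cutoff \<open>w\<close> times a wide Gaussian has as
  Fourier transform the mollification of \<open>w\<close> (\<open>fourier_mollify_preimage\<close>), it is Schwartz as a
  Gaussian times a smooth function with bounded derivatives (\<open>mollify_preimage_schwartz\<close>), and
  \<open>fourier_bessel\<close> bounds its norm by that of \<open>w\<close> uniformly in the scale (\<open>L2_norm_mollify_preimage_le\<close>). The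
  mollified cutoffs converge pointwise to the indicator of \<open>K\<close> (\<open>mollify_minus_le\<close>,
  \<open>tent_tendsto_indicator\<close>) with a polynomially decaying bound of any prescribed order
  (\<open>mollify_le_weight\<close>), which is integrable for \<open>\<sigma>\<close> by the growth condition.
\<close>

section \<open>Rapidly decreasing functions\<close>

text \<open>
  Rapid decay is measured with powers of \<open>1 + |x|\<^sup>2\<close>, without any condition on derivatives. This is
  the only property of a Schwartz function needed to differentiate its Fourier transform or to
  integrate it, and it also covers the compactly supported, merely Lipschitz cutoffs below.
\<close>
definition rapidly_decreasing :: "(real ^ 'n::finite \<Rightarrow> complex) \<Rightarrow> bool" where
  "rapidly_decreasing f \<longleftrightarrow>
     f \<in> borel_measurable borel \<and> (\<forall>p. \<exists>C. \<forall>x. (1 + (norm x)\<^sup>2) ^ p * norm (f x) \<le> C)"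

lemma weight_denominator_pos: "0 < (1 + (norm x)\<^sup>2) ^ p"
  by (intro zero_less_power add_pos_nonneg) auto

text \<open>
  Peetre's inequality: translation by \<open>y\<close> changes the weight \<open>1 + |x|\<^sup>2\<close> at most by a factor
  depending on \<open>y\<close> alone. It transports decay estimates from one point to a nearby one.
\<close>
lemma peetre_inequality:
  fixes x y :: "'a::real_inner"
  shows "1 + (norm (x + y))\<^sup>2 \<le> 2 * (1 + (norm x)\<^sup>2) * (1 + (norm y)\<^sup>2)"
proof -
  have "(norm (x + y))\<^sup>2 \<le> (norm x + norm y)\<^sup>2"
    by (intro power_mono norm_triangle_ineq) auto
  also have "\<dots> \<le> 2 * (norm x)\<^sup>2 + 2 * (norm y)\<^sup>2"
    using sum_squares_bound[of "norm x" "norm y"] by (simp add: power2_sum)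
  finally have *: "(norm (x + y))\<^sup>2 \<le> 2 * (norm x)\<^sup>2 + 2 * (norm y)\<^sup>2" .
  have "0 \<le> (norm x)\<^sup>2 * (norm y)\<^sup>2" by simp
  moreover have "2 * (1 + (norm x)\<^sup>2) * (1 + (norm y)\<^sup>2) =
      2 + 2 * (norm x)\<^sup>2 + 2 * (norm y)\<^sup>2 + 2 * ((norm x)\<^sup>2 * (norm y)\<^sup>2)"
    by (simp add: algebra_simps)
  ultimately show ?thesis using * by linarith
qed

lemma inverse_one_plus_square_finite:
  "(\<integral>\<^sup>+x. ennreal (1 / (1 + x\<^sup>2)) \<partial>lborel) < \<infinity>"
proof -
  have 1: "(\<integral>\<^sup>+x. ennreal (1 / (1 + x\<^sup>2)) * indicator {0..} x \<partial>lborel) = ennreal (pi / 2 - arctan 0)"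
    by (rule nn_integral_FTC_atLeast)
      (auto intro!: derivative_eq_intros tendsto_arctan_at_top simp: field_simps)
  have 2: "(\<integral>\<^sup>+x. ennreal (1 / (1 + x\<^sup>2)) * indicator {..0} x \<partial>lborel) =
      (\<integral>\<^sup>+x. ennreal (1 / (1 + x\<^sup>2)) * indicator {0..} x \<partial>lborel)"
    by (subst nn_integral_real_affine[where c="-1" and t=0])
      (auto intro!: nn_integral_cong simp: indicator_def)
  have "(\<integral>\<^sup>+x. ennreal (1 / (1 + x\<^sup>2)) \<partial>lborel) \<le>
     (\<integral>\<^sup>+x. ennreal (1 / (1 + x\<^sup>2)) * indicator {0..} x + ennreal (1 / (1 + x\<^sup>2)) * indicator {..0} x \<partial>lborel)"
    by (rule nn_integral_mono) (auto simp: indicator_def)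
  also have "\<dots> < \<infinity>"
    by (subst nn_integral_add) (auto simp: 1 2)
  finally show ?thesis .
qed

text \<open>
  The weight is dominated by the product of the one-dimensional functions \<open>1 / (1 + x\<^sub>i\<^sup>2)\<close>, since each
  \<open>x\<^sub>i\<^sup>2\<close> is at most \<open>|x|\<^sup>2\<close>; Tonelli then reduces integrability to the arctangent.
\<close>
lemma weight_integrable:
  "integrable lborel (\<lambda>x::real^'n::finite. 1 / (1 + (norm x)\<^sup>2) ^ CARD('n))"
proof (rule integrableI_bounded)
  let ?w = "\<lambda>x::real^'n. 1 / (1 + (norm x)\<^sup>2) ^ CARD('n)"
  have le: "?w x \<le> (\<Prod>b\<in>Basis. 1 / (1 + (x \<bullet> b)\<^sup>2))" for x :: "real^'n"
  proof -
    have "(\<Prod>b\<in>Basis. 1 + (x \<bullet> b)\<^sup>2) \<le> (\<Prod>b\<in>(Basis::(real^'n) set). 1 + (norm x)\<^sup>2)"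
      by (intro prod_mono) (auto intro!: abs_le_square_iff[THEN iffD1] Basis_le_norm)
    moreover have "(\<Prod>b\<in>Basis. 1 + (x \<bullet> b)\<^sup>2) > 0"
      by (intro prod_pos) (auto intro: add_pos_nonneg)
    ultimately show ?thesis
      by (simp add: prod_dividef divide_left_mono)
  qed
  have "(\<integral>\<^sup>+x. ennreal (norm (?w x)) \<partial>lborel) \<le>
    (\<integral>\<^sup>+x. (\<Prod>b\<in>Basis. ennreal (1 / (1 + ((x::real^'n) \<bullet> b)\<^sup>2))) \<partial>lborel)"
    using le by (intro nn_integral_mono) (auto simp: prod_ennreal intro!: ennreal_leI)
  also have "\<dots> = (\<Prod>b\<in>(Basis::(real^'n) set). (\<integral>\<^sup>+x. ennreal (1 / (1 + x\<^sup>2)) \<partial>lborel))"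
    by (rule nn_integral_lborel_prod) auto
  also have "\<dots> < \<infinity>"
    using inverse_one_plus_square_finite by (auto simp: power_less_top_ennreal)
  finally show "(\<integral>\<^sup>+x. ennreal (norm (?w x)) \<partial>lborel) < \<infinity>" .
qed simp

lemma rapidly_decreasingE:
  assumes "rapidly_decreasing f"
  obtains C where "C \<ge> 0" "\<And>x. (1 + (norm x)\<^sup>2) ^ p * norm (f x) \<le> C"
proof -
  from assms obtain C where C: "\<And>x. (1 + (norm x)\<^sup>2) ^ p * norm (f x) \<le> C"
    unfolding rapidly_decreasing_def by blast
  have "0 \<le> (1 + (norm (0::real^'a))\<^sup>2) ^ p * norm (f 0)" by simp
  also note C[of 0]
  finally show ?thesis using that C by blast
qed

lemma rapidly_decreasing_measurable [measurable_dest]: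
  "rapidly_decreasing f \<Longrightarrow> f \<in> borel_measurable borel"
  by (simp add: rapidly_decreasing_def)

lemma rapidly_decreasing_le_weight:
  assumes "rapidly_decreasing f"
  obtains C where "C \<ge> 0" "\<And>x. norm (f x) \<le> C * (1 / (1 + (norm x)\<^sup>2) ^ p)"
proof -
  obtain C where C: "C \<ge> 0" "\<And>x. (1 + (norm x)\<^sup>2) ^ p * norm (f x) \<le> C"
    using rapidly_decreasingE[OF assms] by metis
  have "norm (f x) \<le> C * (1 / (1 + (norm x)\<^sup>2) ^ p)" for x
    using C(2)[of x] zero_less_power[OF add_pos_nonneg[OF zero_less_one zero_le_power2[of "norm x"]], of p]
    by (simp add: pos_le_divide_eq mult.commute)
  with C(1) that show ?thesis by blast
qed

lemma rapidly_decreasing_integrable: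
  fixes f :: "real^'n::finite \<Rightarrow> complex"
  assumes f: "rapidly_decreasing f"
  shows "integrable lborel f"
proof -
  obtain C where C: "C \<ge> 0" "\<And>x. norm (f x) \<le> C * (1 / (1 + (norm x)\<^sup>2) ^ CARD('n))"
    using rapidly_decreasing_le_weight[OF f] by metis
  show ?thesis
    by (rule Bochner_Integration.integrable_bound[OF integrable_mult_right[OF weight_integrable, of C]])
      (use C f in \<open>auto simp: rapidly_decreasing_def\<close>)
qed

lemma rapidly_decreasing_dominated:
  assumes f: "rapidly_decreasing f" and g: "g \<in> borel_measurable borel"
    and le: "\<And>x. norm (g x) \<le> c * (1 + (norm x)\<^sup>2) ^ k * norm (f x)"
  shows "rapidly_decreasing g"
  unfolding rapidly_decreasing_def
proof (intro conjI allI g)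
  fix p
  obtain C where C: "C \<ge> 0" "\<And>x. (1 + (norm x)\<^sup>2) ^ (p + k) * norm (f x) \<le> C"
    using rapidly_decreasingE[OF f] by metis
  have "(1 + (norm x)\<^sup>2) ^ p * norm (g x) \<le> \<bar>c\<bar> * C" for x
  proof -
    have "(1 + (norm x)\<^sup>2) ^ p * norm (g x) \<le> (1 + (norm x)\<^sup>2) ^ p * (c * (1 + (norm x)\<^sup>2) ^ k * norm (f x))"
      by (intro mult_left_mono le) auto
    also have "\<dots> = c * ((1 + (norm x)\<^sup>2) ^ (p + k) * norm (f x))"
      by (simp add: power_add)
    also have "\<dots> \<le> \<bar>c\<bar> * ((1 + (norm x)\<^sup>2) ^ (p + k) * norm (f x))"
      by (intro mult_right_mono) auto
    also have "\<dots> \<le> \<bar>c\<bar> * C"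
      by (intro mult_left_mono C) auto
    finally show ?thesis .
  qed
  then show "\<exists>C. \<forall>x. (1 + (norm x)\<^sup>2) ^ p * norm (g x) \<le> C" by blast
qed

lemma rapidly_decreasing_add:
  assumes f: "rapidly_decreasing f" and g: "rapidly_decreasing g"
  shows "rapidly_decreasing (\<lambda>x. f x + g x)"
  unfolding rapidly_decreasing_def
proof (intro conjI allI)
  show "(\<lambda>x. f x + g x) \<in> borel_measurable borel"
    using f g by measurable
  fix p
  obtain C where C: "\<And>x. (1 + (norm x)\<^sup>2) ^ p * norm (f x) \<le> C"
    using rapidly_decreasingE[OF f] by metis
  obtain D where D: "\<And>x. (1 + (norm x)\<^sup>2) ^ p * norm (g x) \<le> D"
    using rapidly_decreasingE[OF g] by metis
  have "(1 + (norm x)\<^sup>2) ^ p * norm (f x + g x) \<le> C + D" for x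
  proof -
    have "(1 + (norm x)\<^sup>2) ^ p * norm (f x + g x) \<le> (1 + (norm x)\<^sup>2) ^ p * (norm (f x) + norm (g x))"
      by (intro mult_left_mono norm_triangle_ineq) auto
    with C[of x] D[of x] show ?thesis by (simp add: distrib_left)
  qed
  then show "\<exists>C. \<forall>x. (1 + (norm x)\<^sup>2) ^ p * norm (f x + g x) \<le> C" by blast
qed

lemma norm_le_one_plus_square: "norm x \<le> 1 + (norm x)\<^sup>2"
  using self_le_power[of "norm x" 2] by (cases "norm x \<le> 1") (auto intro: add_increasing2)

lemma rapidly_decreasing_coord:
  assumes f: "rapidly_decreasing f"
  shows "rapidly_decreasing (\<lambda>x. complex_of_real (x $ i) * f x)"
proof (rule rapidly_decreasing_dominated[OF f, of _ 1 1])
  show "(\<lambda>x. complex_of_real (x $ i) * f x) \<in> borel_measurable borel"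
    using f by measurable
  fix x :: "real^'a"
  show "norm (complex_of_real (x $ i) * f x) \<le> 1 * (1 + (norm x)\<^sup>2) ^ 1 * norm (f x)"
    using component_le_norm_cart[of x i] norm_le_one_plus_square[of x]
    by (auto simp: norm_mult intro!: mult_right_mono)
qed

lemma rapidly_decreasing_scale:
  assumes f: "rapidly_decreasing f"
  shows "rapidly_decreasing (\<lambda>x. c * f x)"
  using f by (intro rapidly_decreasing_dominated[OF f, of _ "norm c" 0]) (auto simp: norm_mult)

section \<open>Fourier transforms of rapidly decreasing functions\<close>

lemma norm_character [simp]: "norm (exp (- (\<i> * complex_of_real t))) = 1"
  by (simp add: norm_exp_eq_Re)

lemma character_measurable [measurable]:
  "(\<lambda>x::real^'n::finite. exp (- (\<i> * complex_of_real (u \<bullet> x)))) \<in> borel_measurable borel"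
  by (intro borel_measurable_continuous_onI continuous_intros)

lemma fourier_integrand_integrable:
  fixes f :: "real^'n::finite \<Rightarrow> complex"
  assumes "integrable lborel f"
  shows "integrable lborel (\<lambda>x. exp (- (\<i> * complex_of_real (u \<bullet> x))) * f x)"
  using assms by (rule Bochner_Integration.integrable_bound) (use assms in \<open>auto simp: norm_mult\<close>)

lemma fourier_measurable [measurable]:
  fixes f :: "real^'n::finite \<Rightarrow> complex"
  assumes [measurable]: "f \<in> borel_measurable borel"
  shows "fourier f \<in> borel_measurable borel"
proof -
  have "(\<lambda>z. exp (- (\<i> * complex_of_real (fst z \<bullet> snd z))) * f (snd z))
      \<in> borel_measurable (borel \<Otimes>\<^sub>M lborel)"
    by measurable
  then show ?thesis
    unfolding fourier_def[abs_def]
    by (intro lborel.borel_measurable_lebesgue_integral) (simp add: case_prod_beta')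
qed

lemma fourier_norm_le:
  fixes f :: "real^'n::finite \<Rightarrow> complex"
  assumes "integrable lborel f"
  shows "norm (fourier f u) \<le> (LINT x|lborel. norm (f x))"
  unfolding fourier_def
  using integral_norm_bound[of lborel "\<lambda>x. exp (- (\<i> * complex_of_real (u \<bullet> x))) * f x"]
  by (simp add: norm_mult)

lemma fourier_scale: "fourier (\<lambda>x. c * f x) u = c * fourier f u"
  by (simp add: fourier_def mult.left_commute)

lemma fourier_diff:
  assumes "integrable lborel f" "integrable lborel g"
  shows "fourier (\<lambda>x. f x - g x) u = fourier f u - fourier g u"
  unfolding fourier_def right_diff_distrib
  by (intro Bochner_Integration.integral_diff fourier_integrand_integrable assms)

text \<open>
  The second order remainder of the character \<open>e\<^sup>-\<^sup>i\<^sup>t\<close>, bounded by \<open>t\<^sup>2\<close> for all real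
  \<open>t\<close>, so that it can be integrated against a function with finite second moment.
\<close>
lemma character_taylor:
  "norm (exp (- (\<i> * complex_of_real t)) - 1 + \<i> * complex_of_real t) \<le> t\<^sup>2"
  using Taylor_exp[of "- (\<i> * complex_of_real t)" 1]
  by (simp add: norm_mult power2_eq_square diff_diff_eq2 diff_add_eq[symmetric] flip: diff_diff_add)

text \<open>
  Differentiation under the integral sign. The quadratic remainder of the character,
  integrated against \<open>|f|\<close>, gives a quadratic error with the second moment of \<open>|f|\<close> as constant.
  The derivative is expressed through Fourier transforms of \<open>-\<i> x\<^sub>i f\<close>, which are again of the same kind.
\<close>
lemma fourier_has_derivative:
  fixes f :: "real^'n::finite \<Rightarrow> complex"
  assumes f: "rapidly_decreasing f"
  shows "(fourier f has_derivative
    (\<lambda>y. \<Sum>i\<in>UNIV. complex_of_real (y $ i) * fourier (\<lambda>x. - \<i> * (complex_of_real (x $ i) * f x)) u)) (at u)"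
    (is "(_ has_derivative ?L) _")
proof -
  have [measurable]: "f \<in> borel_measurable borel"
    using f by measurable
  have int: "integrable lborel (\<lambda>x. exp (- (\<i> * complex_of_real (v \<bullet> x))) * f x)" for v
    by (intro fourier_integrand_integrable rapidly_decreasing_integrable f)
  have intx: "integrable lborel (\<lambda>x. exp (- (\<i> * complex_of_real (v \<bullet> x))) *
      (- \<i> * (complex_of_real (x $ i) * f x)))" for v i
    by (intro fourier_integrand_integrable rapidly_decreasing_integrable rapidly_decreasing_scale
        rapidly_decreasing_coord f)
  define M where "M = (LINT x|lborel. (norm x)\<^sup>2 * norm (f x))"
  have "rapidly_decreasing (\<lambda>x. complex_of_real ((norm x)\<^sup>2) * f x)"
    by (rule rapidly_decreasing_dominated[OF f, of _ 1 1]) (auto simp: norm_mult norm_power intro!: mult_right_mono)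
  from integrable_norm[OF rapidly_decreasing_integrable[OF this]]
  have intM: "integrable lborel (\<lambda>x. (norm x)\<^sup>2 * norm (f x))"
    by (simp add: norm_mult norm_power)
  have L: "?L y = (LINT x|lborel. exp (- (\<i> * complex_of_real (u \<bullet> x))) * (- \<i> * complex_of_real (y \<bullet> x) * f x))" for y
  proof -
    have "?L y = (\<Sum>i\<in>UNIV. (LINT x|lborel. complex_of_real (y $ i) *
        (exp (- (\<i> * complex_of_real (u \<bullet> x))) * (- \<i> * (complex_of_real (x $ i) * f x)))))"
      unfolding fourier_def by simp
    also have "\<dots> = (LINT x|lborel. (\<Sum>i\<in>UNIV. complex_of_real (y $ i) *
        (exp (- (\<i> * complex_of_real (u \<bullet> x))) * (- \<i> * (complex_of_real (x $ i) * f x)))))"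
      by (intro Bochner_Integration.integral_sum[symmetric] integrable_mult_right intx)
    also have "\<dots> = (LINT x|lborel. exp (- (\<i> * complex_of_real (u \<bullet> x))) * (- \<i> * complex_of_real (y \<bullet> x) * f x))"
      by (intro Bochner_Integration.integral_cong refl)
        (simp add: inner_vec_def sum_distrib_left sum_distrib_right mult_ac sum_negf)
    finally show ?thesis .
  qed
  have intL: "integrable lborel (\<lambda>x. exp (- (\<i> * complex_of_real (u \<bullet> x))) * (- \<i> * complex_of_real (y \<bullet> x) * f x))" for y
  proof (intro fourier_integrand_integrable rapidly_decreasing_integrable)
    show "rapidly_decreasing (\<lambda>x. - \<i> * complex_of_real (y \<bullet> x) * f x)"
    proof (rule rapidly_decreasing_dominated[OF f, of _ "norm y" 1])
      fix x
      have "\<bar>y \<bullet> x\<bar> \<le> norm y * (1 + (norm x)\<^sup>2)"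
        using Cauchy_Schwarz_ineq2[of y x] mult_left_mono[OF norm_le_one_plus_square[of x], of "norm y"] by simp
      then show "norm (- \<i> * complex_of_real (y \<bullet> x) * f x) \<le> norm y * (1 + (norm x)\<^sup>2) ^ 1 * norm (f x)"
        by (auto simp: norm_mult intro!: mult_right_mono)
    qed measurable
  qed
  have bound: "norm (fourier f (u + y) - fourier f u - ?L y) \<le> M * (norm y)\<^sup>2" for y
  proof -
    have rew: "exp (- (\<i> * complex_of_real ((u + y) \<bullet> x))) * f x - exp (- (\<i> * complex_of_real (u \<bullet> x))) * f x
          - exp (- (\<i> * complex_of_real (u \<bullet> x))) * (- \<i> * complex_of_real (y \<bullet> x) * f x) =
          exp (- (\<i> * complex_of_real (u \<bullet> x))) * f x *
          (exp (- (\<i> * complex_of_real (y \<bullet> x))) - 1 + \<i> * complex_of_real (y \<bullet> x))" for x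
      by (simp add: inner_add_left exp_add algebra_simps exp_diff exp_minus field_simps)
    have "fourier f (u + y) - fourier f u - ?L y = (LINT x|lborel.
       exp (- (\<i> * complex_of_real ((u + y) \<bullet> x))) * f x - exp (- (\<i> * complex_of_real (u \<bullet> x))) * f x
       - exp (- (\<i> * complex_of_real (u \<bullet> x))) * (- \<i> * complex_of_real (y \<bullet> x) * f x))"
      unfolding L unfolding fourier_def
      by (simp add: Bochner_Integration.integral_diff int intL[simplified])
    also have "\<dots> = (LINT x|lborel. exp (- (\<i> * complex_of_real (u \<bullet> x))) * f x *
      (exp (- (\<i> * complex_of_real (y \<bullet> x))) - 1 + \<i> * complex_of_real (y \<bullet> x)))"
      unfolding rew ..
    also have "norm \<dots> \<le> (LINT x|lborel. (norm y)\<^sup>2 * ((norm x)\<^sup>2 * norm (f x)))"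
    proof (rule Bochner_Integration.integral_norm_bound_integral)
      show "integrable lborel (\<lambda>x. exp (- (\<i> * complex_of_real (u \<bullet> x))) * f x *
          (exp (- (\<i> * complex_of_real (y \<bullet> x))) - 1 + \<i> * complex_of_real (y \<bullet> x)))"
        using Bochner_Integration.integrable_diff[OF Bochner_Integration.integrable_diff[OF int[of "u + y"] int[of u]] intL[of y]]
        unfolding rew .
      show "integrable lborel (\<lambda>x. (norm y)\<^sup>2 * ((norm x)\<^sup>2 * norm (f x)))"
        by (intro integrable_mult_right intM)
      fix x
      have "norm (exp (- (\<i> * complex_of_real (y \<bullet> x))) - 1 + \<i> * complex_of_real (y \<bullet> x)) \<le> (y \<bullet> x)\<^sup>2"
        by (rule character_taylor)
      also have "\<dots> \<le> (norm y * norm x)\<^sup>2"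
        using Cauchy_Schwarz_ineq2[of y x] by (intro abs_le_square_iff[THEN iffD1]) simp
      finally show "norm (exp (- (\<i> * complex_of_real (u \<bullet> x))) * f x *
          (exp (- (\<i> * complex_of_real (y \<bullet> x))) - 1 + \<i> * complex_of_real (y \<bullet> x))) \<le>
          (norm y)\<^sup>2 * ((norm x)\<^sup>2 * norm (f x))"
        by (auto simp: norm_mult power_mult_distrib mult.commute[of _ "norm (f x)"] mult.left_commute[of _ "norm (f x)"]
            intro!: mult_left_mono)
    qed
    also have "\<dots> = M * (norm y)\<^sup>2"
      by (simp add: M_def)
    finally show ?thesis .
  qed
  show ?thesis
  proof (rule has_derivativeI_sandwich[of 1 _ _ _ _ "\<lambda>v. M * norm (v - u)"])
    show "bounded_linear ?L"
      by (intro bounded_linear_sum bounded_linear_mult_const bounded_linear_compose[OF bounded_linear_of_real] bounded_linear_vec_nth)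
    fix v assume "v \<noteq> u"
    then show "norm (fourier f v - fourier f u - ?L (v - u)) / norm (v - u) \<le> M * norm (v - u)"
      using bound[of "v - u"] by (simp add: pos_divide_le_eq power2_eq_square mult.assoc)
  next
    show "((\<lambda>v. M * norm (v - u)) \<longlongrightarrow> 0) (at u)"
      by (rule tendsto_eq_intros | simp)+
  qed simp
qed

lemma lborel_integral_translate:
  fixes f :: "'a::euclidean_space \<Rightarrow> 'b::{banach, second_countable_topology}"
  assumes [measurable]: "f \<in> borel_measurable borel"
  shows "(LINT x|lborel. f (a + x)) = (LINT x|lborel. f x)"
  using integral_distr[of "(+) a" lborel borel f] by (simp add: lborel_distr_plus)

lemma partial_deriv_along_axis:
  fixes f :: "real^'n::finite \<Rightarrow> complex"
  assumes "f differentiable (at (x + t *\<^sub>R axis i 1))"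
  shows "((\<lambda>t. f (x + t *\<^sub>R axis i 1)) has_vector_derivative partial_deriv i f (x + t *\<^sub>R axis i 1)) (at t)"
proof -
  let ?D = "frechet_derivative f (at (x + t *\<^sub>R axis i 1))"
  have D: "(f has_derivative ?D) (at (x + t *\<^sub>R axis i 1))"
    using assms by (simp add: frechet_derivative_works)
  have "((\<lambda>t. f (x + t *\<^sub>R axis i 1)) has_derivative (\<lambda>h. ?D (h *\<^sub>R axis i 1))) (at t)"
    by (rule has_derivative_compose[where g=f and f="\<lambda>t. x + t *\<^sub>R axis i 1" and g'="?D", OF _ D]) (auto intro!: derivative_eq_intros)
  then show ?thesis
    by (simp add: has_vector_derivative_def partial_deriv_def linear_scale[OF has_derivative_linear[OF D]])
qed

lemma has_vector_derivative_quotient_tendsto: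
  fixes g :: "real \<Rightarrow> 'a::real_normed_vector"
  assumes "(g has_vector_derivative d) (at 0)"
  shows "((\<lambda>t. (g t - g 0) /\<^sub>R t) \<longlongrightarrow> d) (at 0)"
proof -
  have "((\<lambda>t. norm (g t - g 0 - t *\<^sub>R d) / norm t) \<longlongrightarrow> 0) (at 0)"
    using assms unfolding has_vector_derivative_def has_derivative_iff_norm by simp
  then have "((\<lambda>t. norm ((g t - g 0) /\<^sub>R t - d)) \<longlongrightarrow> 0) (at 0)"
  proof (rule Lim_transform_eventually)
    have "norm (g t - g 0 - t *\<^sub>R d) / norm t = norm ((g t - g 0) /\<^sub>R t - d)" if "t \<noteq> 0" for t
    proof -
      have "(g t - g 0) /\<^sub>R t - d = (g t - g 0 - t *\<^sub>R d) /\<^sub>R t"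
        using that by (simp add: scaleR_diff_right)
      then show ?thesis by (simp add: divide_inverse mult.commute)
    qed
    then show "\<forall>\<^sub>F t in at 0. norm (g t - g 0 - t *\<^sub>R d) / norm t = norm ((g t - g 0) /\<^sub>R t - d)"
      by (simp add: eventually_at_filter)
  qed
  then show ?thesis
    by (simp add: Lim_null[of _ d] tendsto_norm_zero_iff)
qed

text \<open>
  A dominating function for the difference quotients of \<open>f\<close> that does not depend on the step \<open>h\<close>:
  by the mean value inequality the quotient is bounded by the derivative at points within distance
  1 of \<open>x\<close>, where Peetre's inequality lets the decay at \<open>x\<close> be used instead.
\<close>
lemma difference_quotient_along_axis_le:
  fixes f :: "real^'n::finite \<Rightarrow> complex"
  assumes f: "\<And>x. f differentiable (at x)"
    and C: "\<And>x. norm (partial_deriv i f x) \<le> C * (1 / (1 + (norm x)\<^sup>2) ^ p)" "0 \<le> C"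
    and h: "0 < h" "h \<le> 1"
  shows "norm (f (x + h *\<^sub>R axis i 1) - f x) / h \<le> C * 4 ^ p * (1 / (1 + (norm x)\<^sup>2) ^ p)"
proof -
  define B where "B = C * 4 ^ p * (1 / (1 + (norm x)\<^sup>2) ^ p)"
  have der: "((\<lambda>t. f (x + t *\<^sub>R axis i 1)) has_vector_derivative partial_deriv i f (x + t *\<^sub>R axis i 1)) (at t)" for t
    by (rule partial_deriv_along_axis[OF f])
  have bnd: "norm (partial_deriv i f (x + t *\<^sub>R axis i 1)) \<le> B" if "0 < t" "t < h" for t
  proof -
    have "1 + (norm x)\<^sup>2 \<le> 2 * (1 + (norm (x + t *\<^sub>R axis i 1))\<^sup>2) * (1 + t\<^sup>2)"
      using peetre_inequality[of "x + t *\<^sub>R axis i 1" "- (t *\<^sub>R axis i 1)"] by (simp add: norm_axis_1)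
    also have "\<dots> \<le> 2 * (1 + (norm (x + t *\<^sub>R axis i 1))\<^sup>2) * 2"
      using that h power_le_one[of t 2] by (intro mult_left_mono) auto
    finally have "(1 + (norm x)\<^sup>2) ^ p \<le> (4 * (1 + (norm (x + t *\<^sub>R axis i 1))\<^sup>2)) ^ p"
      by (intro power_mono) auto
    then have "1 / (1 + (norm (x + t *\<^sub>R axis i 1))\<^sup>2) ^ p \<le> 4 ^ p / (1 + (norm x)\<^sup>2) ^ p"
      using weight_denominator_pos[of x p] weight_denominator_pos[of "x + t *\<^sub>R axis i 1" p]
      by (simp only: power_mult_distrib) (simp add: field_simps)
    from mult_left_mono[OF this C(2)] C(1)[of "x + t *\<^sub>R axis i 1"]
    show ?thesis by (simp add: B_def)
  qed
  have "norm (f (x + h *\<^sub>R axis i 1) - f (x + 0 *\<^sub>R axis i 1)) \<le> B * h - B * 0"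
  proof (rule differentiable_bound_general[OF h(1), where \<phi>' = "\<lambda>_. B"])
    show "continuous_on {0..h} (\<lambda>t. f (x + t *\<^sub>R axis i 1))"
      using der by (auto intro!: continuous_at_imp_continuous_on has_vector_derivative_continuous)
    show "((*) B has_vector_derivative B) (at t)" for t
      by (auto intro!: derivative_eq_intros simp: has_vector_derivative_def)
  qed (use der bnd in \<open>auto intro!: continuous_intros\<close>)
  then show ?thesis
    using h by (simp add: pos_divide_le_eq B_def)
qed

text \<open>
  Translation invariance of Lebesgue measure replaces integration by parts. The Fourier transform of
  \<open>(f(x + h e\<^sub>i) - f(x)) / h\<close> is \<open>(e\<^sup>i\<^sup>h\<^sup>u - 1) / h\<close> (with \<open>u = u\<^sub>i\<close>) times that of \<open>f\<close>, and both sides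
  converge as \<open>h\<close> tends to 0, the transform of the quotients by dominated convergence.
\<close>
lemma fourier_partial_deriv:
  fixes f :: "real^'n::finite \<Rightarrow> complex"
  assumes f: "rapidly_decreasing f" and df: "rapidly_decreasing (partial_deriv i f)"
    and diff: "\<And>x. f differentiable (at x)"
  shows "fourier (partial_deriv i f) u = \<i> * complex_of_real (u $ i) * fourier f u"
proof -
  have [measurable]: "f \<in> borel_measurable borel" "partial_deriv i f \<in> borel_measurable borel"
    using f df by measurable
  define e :: "real^'n" where "e = axis i 1"
  define h where "h n = inverse (real (Suc n))" for n
  have h: "0 < h n" "h n \<le> 1" for n
    by (auto simp: h_def field_simps)
  have h0: "filterlim h (at 0) sequentially"
    unfolding filterlim_at using LIMSEQ_inverse_real_of_nat h by (auto simp: h_def[abs_def])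
  obtain C where C: "C \<ge> 0" "\<And>x. norm (partial_deriv i f x) \<le> C * (1 / (1 + (norm x)\<^sup>2) ^ CARD('n))"
    using rapidly_decreasing_le_weight[OF df] by metis
  have ue: "u \<bullet> e = u $ i"
    by (simp add: e_def inner_axis)
  have transl: "(LINT x|lborel. exp (- (\<i> * complex_of_real (u \<bullet> x))) * f (x + t *\<^sub>R e)) =
      exp (\<i> * complex_of_real (t * u $ i)) * fourier f u" for t
  proof -
    have "exp (\<i> * complex_of_real (t * u $ i)) * fourier f u =
       (LINT x|lborel. exp (\<i> * complex_of_real (t * u $ i)) * (exp (- (\<i> * complex_of_real (u \<bullet> x))) * f x))"
      by (simp add: fourier_def)
    also have "\<dots> = (LINT x|lborel. exp (\<i> * complex_of_real (t * u $ i)) *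
        (exp (- (\<i> * complex_of_real (u \<bullet> (t *\<^sub>R e + x)))) * f (t *\<^sub>R e + x)))"
      by (rule lborel_integral_translate[symmetric]) measurable
    also have "\<dots> = (LINT x|lborel. exp (- (\<i> * complex_of_real (u \<bullet> x))) * f (x + t *\<^sub>R e))"
    proof (intro Bochner_Integration.integral_cong refl)
      fix x
      have "exp (\<i> * complex_of_real (t * u $ i)) * exp (- (\<i> * complex_of_real (u \<bullet> (t *\<^sub>R e + x)))) =
          exp (- (\<i> * complex_of_real (u \<bullet> x)))"
        unfolding exp_add[symmetric] by (simp add: inner_add_right ue distrib_left)
      then show "exp (\<i> * complex_of_real (t * u $ i)) *
        (exp (- (\<i> * complex_of_real (u \<bullet> (t *\<^sub>R e + x)))) * f (t *\<^sub>R e + x)) =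
        exp (- (\<i> * complex_of_real (u \<bullet> x))) * f (x + t *\<^sub>R e)"
        by (simp add: mult.assoc[symmetric] add.commute)
    qed
    finally show ?thesis by simp
  qed
  have int: "integrable lborel (\<lambda>x. exp (- (\<i> * complex_of_real (u \<bullet> x))) * f x)"
    by (intro fourier_integrand_integrable rapidly_decreasing_integrable f)
  have intt: "integrable lborel (\<lambda>x. exp (- (\<i> * complex_of_real (u \<bullet> x))) * f (x + t *\<^sub>R e))" for t
  proof (rule fourier_integrand_integrable)
    have "integrable (distr lborel borel ((+) (t *\<^sub>R e))) f"
      using rapidly_decreasing_integrable[OF f] by (simp add: lborel_distr_plus)
    then show "integrable lborel (\<lambda>x. f (x + t *\<^sub>R e))"
      by (subst (asm) integrable_distr_eq) (auto simp: add.commute)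
  qed
  let ?Q = "\<lambda>n x. (exp (- (\<i> * complex_of_real (u \<bullet> x))) * f (x + h n *\<^sub>R e)
     - exp (- (\<i> * complex_of_real (u \<bullet> x))) * f x) / complex_of_real (h n)"
  have Q: "(LINT x|lborel. ?Q n x) = (exp (\<i> * complex_of_real (h n * u $ i)) - 1) / complex_of_real (h n) * fourier f u" for n
  proof -
    have "(LINT x|lborel. ?Q n x) = (exp (\<i> * complex_of_real (h n * u $ i)) * fourier f u - fourier f u) / complex_of_real (h n)"
      by (subst integral_divide_zero, subst Bochner_Integration.integral_diff[OF intt int], subst transl)
        (simp add: fourier_def)
    then show ?thesis
      by (simp add: left_diff_distrib)
  qed
  have "(\<lambda>n. LINT x|lborel. ?Q n x) \<longlonglongrightarrow>
      (LINT x|lborel. exp (- (\<i> * complex_of_real (u \<bullet> x))) * partial_deriv i f x)"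
  proof (rule integral_dominated_convergence[where w = "\<lambda>x. C * 4 ^ CARD('n) * (1 / (1 + (norm x)\<^sup>2) ^ CARD('n))"])
    show "integrable lborel (\<lambda>x::real^'n. C * 4 ^ CARD('n) * (1 / (1 + (norm x)\<^sup>2) ^ CARD('n)))"
      by (intro integrable_mult_right weight_integrable)
    show "AE x in lborel. (\<lambda>n. ?Q n x) \<longlonglongrightarrow> exp (- (\<i> * complex_of_real (u \<bullet> x))) * partial_deriv i f x"
    proof (rule AE_I2)
      fix x
      have "((\<lambda>t. f (x + t *\<^sub>R e)) has_vector_derivative partial_deriv i f x) (at 0)"
        using partial_deriv_along_axis[of f x 0 i] diff by (simp add: e_def)
      then have "((\<lambda>t. (f (x + t *\<^sub>R e) - f x) /\<^sub>R t) \<longlongrightarrow> partial_deriv i f x) (at 0)"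
        using has_vector_derivative_quotient_tendsto by fastforce
      from filterlim_compose[OF this h0]
      have "(\<lambda>n. (f (x + h n *\<^sub>R e) - f x) /\<^sub>R h n) \<longlonglongrightarrow> partial_deriv i f x" .
      then have "(\<lambda>n. exp (- (\<i> * complex_of_real (u \<bullet> x))) * ((f (x + h n *\<^sub>R e) - f x) /\<^sub>R h n))
          \<longlonglongrightarrow> exp (- (\<i> * complex_of_real (u \<bullet> x))) * partial_deriv i f x"
        by (intro tendsto_intros)
      then show "(\<lambda>n. ?Q n x) \<longlonglongrightarrow> exp (- (\<i> * complex_of_real (u \<bullet> x))) * partial_deriv i f x"
        by (simp add: scaleR_conv_of_real field_simps)
    qed
    show "AE x in lborel. norm (?Q n x) \<le> C * 4 ^ CARD('n) * (1 / (1 + (norm x)\<^sup>2) ^ CARD('n))" for n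
      using difference_quotient_along_axis_le[OF diff C(2,1) h(1,2)[of n]]
      by (intro AE_I2) (simp add: e_def norm_divide norm_mult abs_of_pos[OF h(1)] flip: right_diff_distrib)
  qed (auto simp: mult.commute)
  moreover have "(\<lambda>n. LINT x|lborel. ?Q n x) \<longlonglongrightarrow> \<i> * complex_of_real (u $ i) * fourier f u"
  proof -
    have "((\<lambda>t. exp (\<i> * complex_of_real (t * u $ i))) has_vector_derivative \<i> * complex_of_real (u $ i)) (at 0)"
      using exp_scaleR_has_vector_derivative_right[of "\<i> * complex_of_real (u $ i)" 0 UNIV]
      by (simp add: scaleR_conv_of_real mult_ac)
    then have "((\<lambda>t. (exp (\<i> * complex_of_real (t * u $ i)) - 1) /\<^sub>R t) \<longlongrightarrow> \<i> * complex_of_real (u $ i)) (at 0)"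
      using has_vector_derivative_quotient_tendsto by fastforce
    from filterlim_compose[OF this h0]
    have "(\<lambda>n. (exp (\<i> * complex_of_real (h n * u $ i)) - 1) / complex_of_real (h n)) \<longlonglongrightarrow> \<i> * complex_of_real (u $ i)"
      by (simp add: scaleR_conv_of_real divide_inverse mult.commute)
    then show ?thesis
      unfolding Q by (intro tendsto_intros)
  qed
  ultimately show ?thesis
    unfolding fourier_def by (rule LIMSEQ_unique)
qed

section \<open>Fourier transforms of Schwartz functions\<close>

lemma norm_square_eq_sum: "(norm x)\<^sup>2 = (\<Sum>i\<in>UNIV. (x $ i)\<^sup>2)" for x :: "real^'n::finite"
  by (simp only: power2_norm_eq_inner) (simp add: inner_vec_def power2_eq_square)

text \<open>
  The weights \<open>(1 + |x|\<^sup>2)\<^sup>p\<close> are polynomials, so decay against all monomials is decay against all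
  weights. The induction on \<open>p\<close> carries an arbitrary monomial along, because multiplying by
  \<open>x\<^sub>j\<^sup>2\<close> changes the exponent vector.
\<close>
lemma rapidly_decreasingI_monomials:
  fixes f :: "real^'n::finite \<Rightarrow> complex"
  assumes meas: "f \<in> borel_measurable borel"
    and bdd: "\<And>\<alpha> :: 'n \<Rightarrow> nat. \<exists>B. \<forall>x. \<bar>\<Prod>i\<in>UNIV. (x $ i) ^ \<alpha> i\<bar> * norm (f x) \<le> B"
  shows "rapidly_decreasing f"
proof -
  have "\<exists>B. \<forall>x. (1 + (norm x)\<^sup>2) ^ p * (\<bar>\<Prod>i\<in>UNIV. (x $ i) ^ \<alpha> i\<bar> * norm (f x)) \<le> B" for p and \<alpha> :: "'n \<Rightarrow> nat"
  proof (induction p arbitrary: \<alpha>)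
    case 0
    then show ?case using bdd[of \<alpha>] by simp
  next
    case (Suc p)
    let ?\<beta> = "\<lambda>j i. \<alpha> i + (if i = j then 2 else 0)"
    obtain B where B: "\<And>\<alpha> x. (1 + (norm x)\<^sup>2) ^ p * (\<bar>\<Prod>i\<in>UNIV. (x $ i) ^ \<alpha> i\<bar> * norm (f x)) \<le> B \<alpha>"
      using Suc.IH by metis
    have "(1 + (norm x)\<^sup>2) ^ Suc p * (\<bar>\<Prod>i\<in>UNIV. (x $ i) ^ \<alpha> i\<bar> * norm (f x)) \<le> B \<alpha> + (\<Sum>j\<in>UNIV. B (?\<beta> j))" for x
    proof -
      have mon: "(x $ j)\<^sup>2 * \<bar>\<Prod>i\<in>UNIV. (x $ i) ^ \<alpha> i\<bar> = \<bar>\<Prod>i\<in>UNIV. (x $ i) ^ ?\<beta> j i\<bar>" for j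
      proof -
        have "(\<Prod>i\<in>UNIV. (x $ i) ^ ?\<beta> j i) = (\<Prod>i\<in>UNIV. (x $ i) ^ \<alpha> i) * (\<Prod>i\<in>UNIV. if i = j then (x $ i)\<^sup>2 else 1)"
          unfolding power_add prod.distrib by (intro arg_cong2[where f="(*)"] refl prod.cong) auto
        then show ?thesis by (simp add: abs_mult mult.commute)
      qed
      have "(1 + (norm x)\<^sup>2) ^ Suc p * (\<bar>\<Prod>i\<in>UNIV. (x $ i) ^ \<alpha> i\<bar> * norm (f x)) =
        (1 + (norm x)\<^sup>2) ^ p * ((1 + (\<Sum>j\<in>UNIV. (x $ j)\<^sup>2)) * \<bar>\<Prod>i\<in>UNIV. (x $ i) ^ \<alpha> i\<bar> * norm (f x))"
        by (simp add: norm_square_eq_sum mult_ac)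
      also have "\<dots> = (1 + (norm x)\<^sup>2) ^ p * (\<bar>\<Prod>i\<in>UNIV. (x $ i) ^ \<alpha> i\<bar> * norm (f x)) +
         (\<Sum>j\<in>UNIV. (1 + (norm x)\<^sup>2) ^ p * (((x $ j)\<^sup>2 * \<bar>\<Prod>i\<in>UNIV. (x $ i) ^ \<alpha> i\<bar>) * norm (f x)))"
        by (simp add: distrib_left distrib_right sum_distrib_left sum_distrib_right)
      also have "\<dots> \<le> B \<alpha> + (\<Sum>j\<in>UNIV. B (?\<beta> j))"
        unfolding mon by (intro add_mono sum_mono B)
      finally show ?thesis .
    qed
    then show ?case by blast
  qed
  from this[of _ "\<lambda>_. 0"] meas show ?thesis
    by (simp add: rapidly_decreasing_def)
qed

lemma rapidly_decreasing_monomial: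
  fixes f :: "real^'n::finite \<Rightarrow> complex"
  assumes "rapidly_decreasing f"
  shows "\<exists>B. \<forall>x. \<bar>\<Prod>i\<in>UNIV. (x $ i) ^ \<alpha> i\<bar> * norm (f x) \<le> B"
proof -
  obtain C where C: "\<And>x. (1 + (norm x)\<^sup>2) ^ (\<Sum>i\<in>UNIV. \<alpha> i) * norm (f x) \<le> C"
    using rapidly_decreasingE[OF assms] by metis
  have "\<bar>\<Prod>i\<in>UNIV. (x $ i) ^ \<alpha> i\<bar> \<le> (1 + (norm x)\<^sup>2) ^ (\<Sum>i\<in>UNIV. \<alpha> i)" for x :: "real^'n"
  proof -
    have "\<bar>\<Prod>i\<in>UNIV. (x $ i) ^ \<alpha> i\<bar> = (\<Prod>i\<in>UNIV. \<bar>x $ i\<bar> ^ \<alpha> i)"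
      by (simp add: abs_prod power_abs)
    also have "\<dots> \<le> (\<Prod>i\<in>UNIV. (1 + (norm x)\<^sup>2) ^ \<alpha> i)"
      by (intro prod_mono conjI power_mono order_trans[OF component_le_norm_cart norm_le_one_plus_square]) auto
    finally show ?thesis by (simp add: power_sum)
  qed
  then show ?thesis
    using C by (meson mult_right_mono norm_ge_zero order_trans)
qed

lemma schwartz_space_iff:
  fixes f :: "real^'n::finite \<Rightarrow> complex"
  shows "f \<in> schwartz_space \<longleftrightarrow>
    (\<forall>is. (\<forall>x. iter_partial_deriv is f differentiable (at x)) \<and> rapidly_decreasing (iter_partial_deriv is f))"
    (is "_ \<longleftrightarrow> (\<forall>is. ?P is)")
proof
  assume f: "f \<in> schwartz_space"
  show "\<forall>is. ?P is"
  proof (intro allI conjI)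
    fix "is"
    show d: "iter_partial_deriv is f differentiable (at x)" for x
      using f by (simp add: schwartz_space_def smooth_def)
    show "rapidly_decreasing (iter_partial_deriv is f)"
    proof (rule rapidly_decreasingI_monomials)
      show "iter_partial_deriv is f \<in> borel_measurable borel"
        using d by (intro borel_measurable_continuous_onI continuous_at_imp_continuous_on ballI
            differentiable_imp_continuous_within)
      fix \<alpha> :: "'n \<Rightarrow> nat"
      show "\<exists>B. \<forall>x. \<bar>\<Prod>i\<in>UNIV. (x $ i) ^ \<alpha> i\<bar> * norm (iter_partial_deriv is f x) \<le> B"
        using f by (auto simp: schwartz_space_def bounded_iff norm_mult simp del: of_real_prod)
    qed
  qed
next
  assume "\<forall>is. ?P is"
  then show "f \<in> schwartz_space"
    using rapidly_decreasing_monomial[of "iter_partial_deriv _ f"]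
    by (auto simp: schwartz_space_def smooth_def bounded_iff norm_mult simp del: of_real_prod)
qed

lemma schwartz_space_rapidly_decreasing: "f \<in> schwartz_space \<Longrightarrow> rapidly_decreasing f"
  using schwartz_space_iff[of f] by (metis iter_partial_deriv_def foldr.simps(1) id_apply)

lemma schwartz_space_differentiable: "f \<in> schwartz_space \<Longrightarrow> f differentiable (at x)"
  using schwartz_space_iff[of f] by (metis iter_partial_deriv_def foldr.simps(1) id_apply)

lemma schwartz_space_partial_deriv: "f \<in> schwartz_space \<Longrightarrow> partial_deriv i f \<in> schwartz_space"
proof -
  have "iter_partial_deriv is (partial_deriv i f) = iter_partial_deriv (is @ [i]) f" for "is"
    by (simp add: iter_partial_deriv_def)
  then show "f \<in> schwartz_space \<Longrightarrow> partial_deriv i f \<in> schwartz_space"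
    unfolding schwartz_space_iff by metis
qed

text \<open>
  Since \<open>|u|\<^sup>2\<close> times the Fourier transform of \<open>f\<close> is, up to sign, the Fourier transform of the
  Laplacian of \<open>f\<close>, each power of the weight is paid for by two derivatives, and the Fourier transform
  of an integrable function is bounded. This makes \<open>spectral_form \<sigma>\<close> finite on Schwartz functions.
\<close>
lemma fourier_schwartz_rapidly_decreasing:
  fixes f :: "real^'n::finite \<Rightarrow> complex"
  assumes "f \<in> schwartz_space"
  shows "rapidly_decreasing (fourier f)"
  unfolding rapidly_decreasing_def
proof (intro conjI allI)
  show "fourier f \<in> borel_measurable borel"
    using schwartz_space_rapidly_decreasing[OF assms] by measurable
  fix p
  from assms show "\<exists>C. \<forall>u. (1 + (norm u)\<^sup>2) ^ p * norm (fourier f u) \<le> C"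
  proof (induction p arbitrary: f)
    case 0
    have "norm (fourier f u) \<le> (LINT x|lborel. norm (f x))" for u
      by (intro fourier_norm_le rapidly_decreasing_integrable schwartz_space_rapidly_decreasing 0)
    then show ?case by auto
  next
    case (Suc p)
    obtain C where C: "\<And>(f :: real^'n \<Rightarrow> complex) u. f \<in> schwartz_space \<Longrightarrow> (1 + (norm u)\<^sup>2) ^ p * norm (fourier f u) \<le> C f"
    proof -
      have "\<forall>f :: real^'n \<Rightarrow> complex. \<exists>C. f \<in> schwartz_space \<longrightarrow> (\<forall>u. (1 + (norm u)\<^sup>2) ^ p * norm (fourier f u) \<le> C)"
        using Suc.IH by blast
      from choice[OF this] obtain C where C: "\<forall>f :: real^'n \<Rightarrow> complex. f \<in> schwartz_space \<longrightarrow> (\<forall>u. (1 + (norm u)\<^sup>2) ^ p * norm (fourier f u) \<le> C f)"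
        by (elim exE)
      then show thesis by (intro that[of C]) blast
    qed
    have F: "fourier (partial_deriv i g) u = \<i> * complex_of_real (u $ i) * fourier g u"
      if "g \<in> schwartz_space" for g i u
      by (intro fourier_partial_deriv schwartz_space_rapidly_decreasing schwartz_space_partial_deriv
          schwartz_space_differentiable that)
    let ?L = "\<lambda>i. partial_deriv i (partial_deriv i f)"
    have L: "?L i \<in> schwartz_space" for i
      by (intro schwartz_space_partial_deriv Suc.prems)
    have "(1 + (norm u)\<^sup>2) ^ Suc p * norm (fourier f u) \<le> C f + (\<Sum>i\<in>UNIV. C (?L i))" for u
    proof -
      have FL: "norm (fourier (?L i) u) = (u $ i)\<^sup>2 * norm (fourier f u)" for i
        using Suc.prems by (simp add: F schwartz_space_partial_deriv norm_mult power2_eq_square abs_mult[symmetric])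
      have "(1 + (norm u)\<^sup>2) ^ Suc p * norm (fourier f u) =
        (1 + (norm u)\<^sup>2) ^ p * ((1 + (\<Sum>j\<in>UNIV. (u $ j)\<^sup>2)) * norm (fourier f u))"
        by (simp add: norm_square_eq_sum mult_ac)
      also have "\<dots> = (1 + (norm u)\<^sup>2) ^ p * norm (fourier f u) + (\<Sum>i\<in>UNIV. (1 + (norm u)\<^sup>2) ^ p * norm (fourier (?L i) u))"
        by (simp add: FL distrib_left distrib_right sum_distrib_left sum_distrib_right)
      also have "\<dots> \<le> C f + (\<Sum>i\<in>UNIV. C (?L i))"
        by (intro add_mono sum_mono C L Suc.prems)
      finally show ?thesis .
    qed
    then show ?case by blast
  qed
qed

section \<open>The Gaussian and its Fourier transform\<close>

definition gaussian :: "real^'n::finite \<Rightarrow> real" where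
  "gaussian x = exp (- (x \<bullet> x) / 2)"

lemma gaussian_measurable [measurable]: "gaussian \<in> borel_measurable borel"
  unfolding gaussian_def[abs_def] by measurable

lemma gaussian_pos: "0 < gaussian x"
  by (simp add: gaussian_def)

lemma gaussian_le_1: "gaussian x \<le> 1"
  by (simp add: gaussian_def)

lemma gaussian_rapidly_decreasing:
  "rapidly_decreasing (\<lambda>x::real^'n::finite. complex_of_real (gaussian x))"
  unfolding rapidly_decreasing_def
proof (intro conjI allI)
  fix p :: nat
  have "(1 + (norm x)\<^sup>2) ^ p * norm (complex_of_real (gaussian x)) \<le> (2 * real (Suc p)) ^ Suc p * exp (1 / 2)" for x :: "real^'n"
  proof -
    define t where "t = (1 + (norm x)\<^sup>2) / (2 * real (Suc p))"
    have t: "0 \<le> t" by (auto simp: t_def)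
    \<comment> \<open>The exponent \<open>p + 1\<close> is used because \<open>t\<close> divides by it, and \<open>p\<close> may be 0; \<open>t\<close> is chosen such that its exponential to the power \<open>p + 1\<close> is \<open>e\<^sup>1\<^sup>/\<^sup>2\<close> divided by the Gaussian.\<close>
    have "(1 + (norm x)\<^sup>2) ^ p \<le> (1 + (norm x)\<^sup>2) ^ Suc p"
      by (intro power_increasing) auto
    also have "\<dots> = (2 * real (Suc p)) ^ Suc p * t ^ Suc p"
      unfolding power_mult_distrib[symmetric] by (simp add: t_def del: power_Suc)
    also have "\<dots> \<le> (2 * real (Suc p)) ^ Suc p * exp t ^ Suc p"
      using exp_ge_add_one_self[of t] t by (intro mult_left_mono power_mono) (auto simp del: exp_ge_add_one_self)
    also have "exp t ^ Suc p = exp (1 / 2) * exp ((norm x)\<^sup>2 / 2)"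
      unfolding exp_of_nat_mult[symmetric] exp_add[symmetric] by (simp add: t_def field_simps)
    finally have "(1 + (norm x)\<^sup>2) ^ p \<le> (2 * real (Suc p)) ^ Suc p * exp (1 / 2) * exp ((norm x)\<^sup>2 / 2)"
      by (simp add: mult.assoc)
    then have "(1 + (norm x)\<^sup>2) ^ p * gaussian x \<le>
        (2 * real (Suc p)) ^ Suc p * exp (1 / 2) * exp ((norm x)\<^sup>2 / 2) * gaussian x"
      using gaussian_pos[of x] by (intro mult_right_mono) auto
    also have "\<dots> = (2 * real (Suc p)) ^ Suc p * exp (1 / 2) * (exp ((norm x)\<^sup>2 / 2) * gaussian x)"
      by (simp only: mult.assoc)
    also have "exp ((norm x)\<^sup>2 / 2) * gaussian x = 1"
      by (simp add: gaussian_def power2_norm_eq_inner exp_add[symmetric])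
    finally show ?thesis
      using gaussian_pos[of x] by simp
  qed
  then show "\<exists>C. \<forall>x::real^'n. (1 + (norm x)\<^sup>2) ^ p * norm (complex_of_real (gaussian x)) \<le> C" by blast
qed measurable

lemma gaussian_has_derivative:
  "(gaussian has_derivative (\<lambda>h. - (x \<bullet> h) * gaussian x)) (at x)"
  unfolding gaussian_def[abs_def]
  by (auto intro!: derivative_eq_intros simp: inner_commute fun_eq_iff)

lemma partial_deriv_eqI:
  assumes "(f has_derivative D) (at x)"
  shows "partial_deriv i f x = D (axis i 1)"
  using frechet_derivative_at[OF assms] by (simp add: partial_deriv_def)

text \<open>
  The constant \<open>(2 \<pi>)\<^sup>n\<^sup>/\<^sup>2\<close>, kept as an integral so that no Gaussian integral has to be evaluated.
\<close>
definition gaussian_mass :: "'n::finite itself \<Rightarrow> real" where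
  "gaussian_mass _ = (LINT x|lborel. gaussian (x :: real^'n))"

lemma gaussian_integrable: "integrable lborel (gaussian :: real^'n::finite \<Rightarrow> real)"
  using integrable_norm[OF rapidly_decreasing_integrable[OF gaussian_rapidly_decreasing]]
  by (simp add: less_imp_le[OF gaussian_pos])

lemma gaussian_mass_pos: "0 < gaussian_mass TYPE('n::finite)"
proof -
  have "gaussian_mass TYPE('n) \<noteq> 0"
  proof
    assume "gaussian_mass TYPE('n) = 0"
    then have "AE x in lborel. gaussian (x :: real^'n) = 0"
      unfolding gaussian_mass_def
      by (subst (asm) integral_nonneg_eq_0_iff_AE[OF gaussian_integrable])
        (auto simp: less_imp_le[OF gaussian_pos])
    then have "AE x in lborel :: (real^'n) measure. False"
      by eventually_elim (use gaussian_pos in \<open>metis less_irrefl\<close>)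
    then show False by (simp add: eventually_False ae_filter_eq_bot_iff)
  qed
  moreover have "0 \<le> gaussian_mass TYPE('n)"
    unfolding gaussian_mass_def by (intro integral_nonneg_AE) (simp add: less_imp_le[OF gaussian_pos])
  ultimately show ?thesis by simp
qed

text \<open>
  The Gaussian \<open>G\<close> satisfies \<open>\<partial>\<^sub>i G = - x\<^sub>i G\<close>. The Fourier transform exchanges the two sides of this
  equation, so the Fourier transform of \<open>G\<close> solves the same first order system; its quotient
  by \<open>G\<close> therefore has derivative 0, and the constant is the value at the origin.
\<close>
theorem fourier_gaussian:
  "fourier (\<lambda>x::real^'n::finite. complex_of_real (gaussian x)) u =
     complex_of_real (gaussian_mass TYPE('n) * gaussian u)"
proof -
  let ?G = "\<lambda>x::real^'n. complex_of_real (gaussian x)"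
  let ?E = "\<lambda>u::real^'n. complex_of_real (exp ((u \<bullet> u) / 2))"
  have der: "(?G has_derivative (\<lambda>h. complex_of_real (- (x \<bullet> h) * gaussian x))) (at x)" for x
    by (rule has_derivative_of_real[OF gaussian_has_derivative])
  have pd: "partial_deriv i ?G = (\<lambda>x. - 1 * (complex_of_real (x $ i) * ?G x))" for i
    using partial_deriv_eqI[OF der, of i] by (simp add: fun_eq_iff inner_axis)
  have xG: "fourier (\<lambda>x. - \<i> * (complex_of_real (x $ i) * ?G x)) u = - complex_of_real (u $ i) * fourier ?G u" for i u
  proof -
    have "fourier (\<lambda>x. - \<i> * (complex_of_real (x $ i) * ?G x)) u = \<i> * fourier (partial_deriv i ?G) u"
      unfolding pd fourier_scale by simp
    also have "fourier (partial_deriv i ?G) u = \<i> * complex_of_real (u $ i) * fourier ?G u"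
    proof (rule fourier_partial_deriv[OF gaussian_rapidly_decreasing])
      show "rapidly_decreasing (partial_deriv i ?G)"
        unfolding pd by (intro rapidly_decreasing_scale rapidly_decreasing_coord gaussian_rapidly_decreasing)
      show "?G differentiable (at x)" for x
        using der by (auto simp: differentiable_def)
    qed
    also have "\<i> * (\<i> * complex_of_real (u $ i) * fourier ?G u) = - complex_of_real (u $ i) * fourier ?G u"
      by (simp add: mult.assoc[symmetric])
    finally show ?thesis .
  qed
  have F: "(fourier ?G has_derivative (\<lambda>y. - complex_of_real (y \<bullet> u) * fourier ?G u)) (at u)" for u
    using fourier_has_derivative[OF gaussian_rapidly_decreasing, of u]
    unfolding xG by (simp add: inner_vec_def sum_distrib_right sum_negf mult.assoc)
  \<comment> \<open>\<open>?E\<close> is the reciprocal of the Gaussian.\<close>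
  have "((\<lambda>u. fourier ?G u * ?E u) has_derivative (\<lambda>h. 0)) (at u)" for u
  proof -
    have "(?E has_derivative (\<lambda>h. complex_of_real (h \<bullet> u) * ?E u)) (at u)"
      by (rule has_derivative_eq_rhs, rule has_derivative_of_real, (rule derivative_intros)+)
        (auto simp: inner_commute fun_eq_iff)
    from has_derivative_mult[OF F this] show ?thesis
      by (simp add: mult_ac)
  qed
  then obtain c where c: "\<And>u. fourier ?G u * ?E u = c"
    using has_derivative_zero_constant[of UNIV "\<lambda>u. fourier ?G u * ?E u"] by auto
  have "fourier ?G 0 = complex_of_real (gaussian_mass TYPE('n))"
    by (simp add: fourier_def gaussian_mass_def)
  with c[of 0] have "c = complex_of_real (gaussian_mass TYPE('n))" by simp
  with c[of u] show ?thesis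
    by (simp add: gaussian_def exp_minus field_simps)
qed

lemma lborel_integral_affine:
  fixes f :: "real^'n::finite \<Rightarrow> 'b::{banach, second_countable_topology}"
  assumes [measurable]: "f \<in> borel_measurable borel" and c: "c \<noteq> 0"
  shows "(LINT x|lborel. f x) = \<bar>c\<bar> ^ CARD('n) *\<^sub>R (LINT x|lborel. f (t + c *\<^sub>R x))"
  by (subst lborel_affine[OF c, of t], subst integral_density)
    (auto simp: integral_distr)

lemma rapidly_decreasing_dilate:
  fixes f :: "real^'n::finite \<Rightarrow> complex"
  assumes f: "rapidly_decreasing f" and c: "c \<noteq> 0"
  shows "rapidly_decreasing (\<lambda>x. f (c *\<^sub>R x))"
  unfolding rapidly_decreasing_def
proof (intro conjI allI)
  have [measurable]: "f \<in> borel_measurable borel"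
    using f by measurable
  show "(\<lambda>x. f (c *\<^sub>R x)) \<in> borel_measurable borel"
    by measurable
  fix p
  obtain C where C: "C \<ge> 0" "\<And>x. (1 + (norm x)\<^sup>2) ^ p * norm (f x) \<le> C"
    using rapidly_decreasingE[OF f] by metis
  have "(1 + (norm x)\<^sup>2) ^ p * norm (f (c *\<^sub>R x)) \<le> (1 + 1 / c\<^sup>2) ^ p * C" for x
  proof -
    have "1 + (norm x)\<^sup>2 \<le> (1 + 1 / c\<^sup>2) * (1 + (norm (c *\<^sub>R x))\<^sup>2)"
      using c by (simp add: power_mult_distrib distrib_left distrib_right)
    then have "(1 + (norm x)\<^sup>2) ^ p \<le> (1 + 1 / c\<^sup>2) ^ p * (1 + (norm (c *\<^sub>R x))\<^sup>2) ^ p"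
      unfolding power_mult_distrib[symmetric] by (intro power_mono) auto
    then have "(1 + (norm x)\<^sup>2) ^ p * norm (f (c *\<^sub>R x)) \<le>
        (1 + 1 / c\<^sup>2) ^ p * (1 + (norm (c *\<^sub>R x))\<^sup>2) ^ p * norm (f (c *\<^sub>R x))"
      by (intro mult_right_mono) auto
    also have "\<dots> \<le> (1 + 1 / c\<^sup>2) ^ p * C"
      unfolding mult.assoc by (intro mult_left_mono C) auto
    finally show ?thesis .
  qed
  then show "\<exists>C. \<forall>x. (1 + (norm x)\<^sup>2) ^ p * norm (f (c *\<^sub>R x)) \<le> C" by blast
qed

lemma gaussian_uminus [simp]: "gaussian (- x) = gaussian x"
  by (simp add: gaussian_def)

text \<open>
  The Fourier transform of the dilated Gaussian \<open>gaussian (\<epsilon> x)\<close>. For fixed \<open>n\<close> its total mass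
  does not depend on \<open>\<epsilon>\<close>; this is what makes the Bessel inequality below uniform in \<open>\<epsilon>\<close>.
\<close>
definition gaussian_kernel :: "real \<Rightarrow> real^'n::finite \<Rightarrow> real" where
  "gaussian_kernel \<epsilon> x = gaussian_mass TYPE('n) / \<epsilon> ^ CARD('n) * gaussian (x /\<^sub>R \<epsilon>)"

lemma gaussian_kernel_measurable [measurable]: "gaussian_kernel \<epsilon> \<in> borel_measurable borel"
  unfolding gaussian_kernel_def[abs_def] by measurable

lemma gaussian_kernel_nonneg: "0 < \<epsilon> \<Longrightarrow> 0 \<le> gaussian_kernel \<epsilon> x"
  using less_imp_le[OF gaussian_mass_pos[where 'n='a]] less_imp_le[OF gaussian_pos[of "x /\<^sub>R \<epsilon>"]]
  by (simp add: gaussian_kernel_def)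

lemma gaussian_kernel_uminus [simp]: "gaussian_kernel \<epsilon> (- x) = gaussian_kernel \<epsilon> x"
  by (simp add: gaussian_kernel_def)

lemma fourier_dilated_gaussian:
  fixes u :: "real^'n::finite"
  assumes \<epsilon>: "0 < \<epsilon>"
  shows "fourier (\<lambda>x. complex_of_real (gaussian (\<epsilon> *\<^sub>R x))) u = complex_of_real (gaussian_kernel \<epsilon> u)"
proof -
  let ?g = "\<lambda>y. exp (- (\<i> * complex_of_real ((u /\<^sub>R \<epsilon>) \<bullet> y))) * complex_of_real (gaussian y)"
  have "complex_of_real (gaussian_mass TYPE('n) * gaussian (u /\<^sub>R \<epsilon>)) = (LINT y|lborel. ?g y)"
    using fourier_gaussian[of "u /\<^sub>R \<epsilon>"] by (simp add: fourier_def)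
  also have "\<dots> = \<bar>\<epsilon>\<bar> ^ CARD('n) *\<^sub>R (LINT x|lborel. ?g (0 + \<epsilon> *\<^sub>R x))"
    using \<epsilon> by (intro lborel_integral_affine) auto
  also have "(LINT x|lborel. ?g (0 + \<epsilon> *\<^sub>R x)) = fourier (\<lambda>x. complex_of_real (gaussian (\<epsilon> *\<^sub>R x))) u"
  proof -
    have *: "(u /\<^sub>R \<epsilon>) \<bullet> (0 + \<epsilon> *\<^sub>R x) = u \<bullet> x" for x
      using \<epsilon> by simp
    show ?thesis unfolding fourier_def * by simp
  qed
  finally show ?thesis
    using \<epsilon> by (simp add: gaussian_kernel_def scaleR_conv_of_real field_simps)
qed

lemma gaussian_kernel_integral:
  assumes \<epsilon>: "0 < \<epsilon>"
  shows "(LINT x|lborel. gaussian_kernel \<epsilon> (x :: real^'n::finite)) = (gaussian_mass TYPE('n))\<^sup>2"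
  using lborel_integral_affine[of "gaussian_kernel \<epsilon> :: real^'n \<Rightarrow> real" \<epsilon> 0] \<epsilon>
  by (simp add: gaussian_kernel_def power2_eq_square) (simp add: gaussian_mass_def)

lemma gaussian_kernel_integrable:
  assumes \<epsilon>: "0 < \<epsilon>"
  shows "integrable lborel (gaussian_kernel \<epsilon> :: real^'n::finite \<Rightarrow> real)"
proof (rule ccontr)
  assume "\<not> ?thesis"
  then have "(LINT x|lborel. gaussian_kernel \<epsilon> (x :: real^'n)) = 0"
    by (rule not_integrable_integral_eq)
  then show False
    using gaussian_kernel_integral[OF \<epsilon>, where 'n='n] gaussian_mass_pos[where 'n='n] by simp
qed

lemma gaussian_kernel_nn_integral:
  assumes \<epsilon>: "0 < \<epsilon>"
  shows "(\<integral>\<^sup>+x. ennreal (gaussian_kernel \<epsilon> (x :: real^'n::finite)) \<partial>lborel) = ennreal ((gaussian_mass TYPE('n))\<^sup>2)"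
  using nn_integral_eq_integral[OF gaussian_kernel_integrable[OF \<epsilon>, where 'n='n]]
    gaussian_kernel_nonneg[OF \<epsilon>] gaussian_kernel_integral[OF \<epsilon>, where 'n='n]
  by (metis AE_I2)

lemma gaussian_kernel_nn_integral_translate:
  fixes y :: "real^'n::finite"
  assumes \<epsilon>: "0 < \<epsilon>"
  shows "(\<integral>\<^sup>+x. ennreal (gaussian_kernel \<epsilon> (x - y)) \<partial>lborel) = ennreal ((gaussian_mass TYPE('n))\<^sup>2)"
proof -
  have "(\<integral>\<^sup>+x. ennreal (gaussian_kernel \<epsilon> (x - y)) \<partial>lborel) =
     (\<integral>\<^sup>+x. ennreal (gaussian_kernel \<epsilon> x) \<partial>distr lborel borel ((+) (- y)))"
    by (subst nn_integral_distr) auto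
  then show ?thesis
    using gaussian_kernel_nn_integral[OF \<epsilon>, where 'n='n] by (simp add: lborel_distr_plus)
qed

section \<open>Gaussian cutoffs and a Bessel inequality\<close>

lemma fourier_multiplication_formula:
  fixes f h :: "real^'n::finite \<Rightarrow> complex"
  assumes f: "integrable lborel f" and h: "integrable lborel h"
  shows "(LINT u|lborel. fourier f u * h u) = (LINT x|lborel. f x * fourier h x)"
proof -
  have [measurable]: "f \<in> borel_measurable borel" "h \<in> borel_measurable borel"
    using f h by auto
  let ?K = "\<lambda>(u, x). exp (- (\<i> * complex_of_real (u \<bullet> x))) * f x * h u"
  have "integrable (lborel \<Otimes>\<^sub>M lborel) ?K"
  proof (rule lborel_pair.Fubini_integrable)
    have "(\<lambda>z. exp (- (\<i> * complex_of_real (fst z \<bullet> snd z))) * f (snd z) * h (fst z))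
        \<in> borel_measurable (lborel \<Otimes>\<^sub>M lborel)"
      by measurable
    then show "?K \<in> borel_measurable (lborel \<Otimes>\<^sub>M lborel)"
      by (simp add: case_prod_beta')
    have "integrable lborel (\<lambda>u. norm (h u) * (LINT x|lborel. norm (f x)))"
      using h by (intro integrable_mult_left integrable_norm)
    then show "integrable lborel (\<lambda>u. LINT x|lborel. norm (?K (u, x)))"
      by (simp add: norm_mult mult.commute)
    show "AE u in lborel. integrable lborel (\<lambda>x. ?K (u, x))"
      using fourier_integrand_integrable[OF f] by (intro AE_I2) (simp add: integrable_mult_left)
  qed
  from lborel_pair.Fubini_integral[OF this]
  have "(LINT x|lborel. LINT u|lborel. exp (- (\<i> * complex_of_real (u \<bullet> x))) * f x * h u) =
    (LINT u|lborel. LINT x|lborel. exp (- (\<i> * complex_of_real (u \<bullet> x))) * f x * h u)"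
    by simp
  moreover have "(LINT u|lborel. exp (- (\<i> * complex_of_real (u \<bullet> x))) * f x * h u) = f x * fourier h x" for x
    unfolding fourier_def
    by (subst integral_mult_right_zero[symmetric]) (simp add: mult_ac inner_commute)
  ultimately show ?thesis
    by (simp add: fourier_def)
qed

text \<open>
  Regularised Fourier inversion. Inserting a Gaussian cutoff makes the inverse transform of the
  Fourier transform of \<open>w\<close> absolutely convergent, and the multiplication formula moves the transform onto the
  modulated cutoff, whose transform is a translated Gaussian kernel.
\<close>
lemma fourier_gaussian_cutoff:
  fixes w :: "real^'n::finite \<Rightarrow> complex"
  assumes w: "integrable lborel w" and \<epsilon>: "0 < \<epsilon>"
  shows "fourier (\<lambda>x. complex_of_real (gaussian (\<epsilon> *\<^sub>R x)) * fourier w (- x)) u =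
    (LINT v|lborel. w v * complex_of_real (gaussian_kernel \<epsilon> (u - v)))"
proof -
  have [measurable]: "w \<in> borel_measurable borel" using w by auto
  let ?h = "\<lambda>x. exp (- (\<i> * complex_of_real ((- u) \<bullet> x))) * complex_of_real (gaussian (\<epsilon> *\<^sub>R x))"
  have Gint: "integrable lborel (\<lambda>x::real^'n. complex_of_real (gaussian (\<epsilon> *\<^sub>R x)))"
    using \<epsilon> by (intro rapidly_decreasing_integrable rapidly_decreasing_dilate[OF gaussian_rapidly_decreasing]) auto
  have "fourier (\<lambda>x. complex_of_real (gaussian (\<epsilon> *\<^sub>R x)) * fourier w (- x)) u =
    (LINT x|lborel. exp (- (\<i> * complex_of_real (u \<bullet> x))) * (complex_of_real (gaussian (\<epsilon> *\<^sub>R x)) * fourier w (- x)))"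
    by (simp add: fourier_def)
  also have "\<dots> = (LINT x|lborel. fourier w x * ?h x)"
    by (subst lborel_integral_affine[where c="-1" and t=0]) (auto simp: mult_ac)
  also have "\<dots> = (LINT v|lborel. w v * fourier ?h v)"
    by (intro fourier_multiplication_formula w fourier_integrand_integrable Gint)
  finally have 1: "fourier (\<lambda>x. complex_of_real (gaussian (\<epsilon> *\<^sub>R x)) * fourier w (- x)) u =
    (LINT v|lborel. w v * fourier ?h v)" .
  have 2: "fourier ?h v = complex_of_real (gaussian_kernel \<epsilon> (u - v))" for v
  proof -
    have "fourier ?h v = fourier (\<lambda>x. complex_of_real (gaussian (\<epsilon> *\<^sub>R x))) (v - u)"
      unfolding fourier_def
      by (simp add: mult.assoc[symmetric] exp_add[symmetric] inner_diff_left right_diff_distrib)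
    also have "\<dots> = complex_of_real (gaussian_kernel \<epsilon> (- (u - v)))"
      by (simp add: fourier_dilated_gaussian[OF \<epsilon>])
    finally show ?thesis
      by (simp only: gaussian_kernel_uminus)
  qed
  show ?thesis
    unfolding 1 2 ..
qed

lemma fourier_cnj: "fourier (\<lambda>x. cnj (f x)) (- u) = cnj (fourier f u)"
proof -
  have "fourier (\<lambda>x. cnj (f x)) (- u) = (LINT x|lborel. cnj (exp (- (\<i> * complex_of_real (u \<bullet> x))) * f x))"
    unfolding fourier_def by (intro Bochner_Integration.integral_cong refl) (simp add: exp_cnj)
  then show ?thesis
    by (simp only: fourier_def Bochner_Integration.integral_cnj)
qed

text \<open>
  Schur's test for a translation invariant kernel: \<open>|f(x)| |f(y)|\<close> is at most the mean of the two squares, and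
  integrating the kernel in the other variable produces its total mass.
\<close>
lemma gaussian_schur:
  fixes f :: "real^'n::finite \<Rightarrow> complex"
  assumes [measurable]: "f \<in> borel_measurable borel" and \<epsilon>: "0 < \<epsilon>"
  shows "(\<integral>\<^sup>+x. (\<integral>\<^sup>+y. ennreal (norm (f x) * (norm (f y) * gaussian_kernel \<epsilon> (x - y))) \<partial>lborel) \<partial>lborel)
    \<le> ennreal ((gaussian_mass TYPE('n))\<^sup>2) * (\<integral>\<^sup>+x. ennreal ((norm (f x))\<^sup>2) \<partial>lborel)" (is "?l \<le> ?m * ?N")
proof -
  let ?k = "\<lambda>x y :: real^'n. gaussian_kernel \<epsilon> (x - y)"
  have k: "0 \<le> ?k x y" for x y by (rule gaussian_kernel_nonneg[OF \<epsilon>])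
  have k1: "(\<integral>\<^sup>+y. ennreal (?k x y) \<partial>lborel) = ?m" for x
    using gaussian_kernel_nn_integral_translate[OF \<epsilon>, of x] gaussian_kernel_uminus[of \<epsilon> "x - _"]
    by simp
  let ?A = "\<lambda>x y. ennreal ((norm (f x))\<^sup>2 / 2) * ennreal (?k x y)"
  let ?B = "\<lambda>x y. ennreal ((norm (f y))\<^sup>2 / 2) * ennreal (?k x y)"
  have half: "(\<integral>\<^sup>+x. ennreal ((norm (f x))\<^sup>2 / 2) * ?m \<partial>lborel) + (\<integral>\<^sup>+x. ennreal ((norm (f x))\<^sup>2 / 2) * ?m \<partial>lborel) = ?m * ?N"
  proof -
    have "(\<integral>\<^sup>+x. ennreal ((norm (f x))\<^sup>2 / 2) * ?m \<partial>lborel) + (\<integral>\<^sup>+x. ennreal ((norm (f x))\<^sup>2 / 2) * ?m \<partial>lborel) =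
      (\<integral>\<^sup>+x. ennreal ((norm (f x))\<^sup>2 / 2) * ?m + ennreal ((norm (f x))\<^sup>2 / 2) * ?m \<partial>lborel)"
      by (rule nn_integral_add[symmetric]) auto
    also have "\<dots> = (\<integral>\<^sup>+x. ?m * ennreal ((norm (f x))\<^sup>2) \<partial>lborel)"
      unfolding distrib_right[symmetric]
      by (intro nn_integral_cong) (simp add: ennreal_plus[symmetric] mult.commute del: ennreal_plus)
    also have "\<dots> = ?m * ?N"
      by (rule nn_integral_cmult) auto
    finally show ?thesis .
  qed
  have "?l \<le> (\<integral>\<^sup>+x. (\<integral>\<^sup>+y. ?A x y + ?B x y \<partial>lborel) \<partial>lborel)"
  proof (intro nn_integral_mono)
    fix x y
    have "norm (f x) * norm (f y) \<le> (norm (f x))\<^sup>2 / 2 + (norm (f y))\<^sup>2 / 2"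
      using sum_squares_bound[of "norm (f x)" "norm (f y)"] by simp
    from mult_right_mono[OF this k[of x y]]
    show "ennreal (norm (f x) * (norm (f y) * ?k x y)) \<le> ?A x y + ?B x y"
      using k[of x y] by (simp add: ennreal_mult[symmetric] ennreal_plus[symmetric] distrib_right mult.assoc
          del: ennreal_plus) 
  qed
  also have "\<dots> = (\<integral>\<^sup>+x. (\<integral>\<^sup>+y. ?A x y \<partial>lborel) \<partial>lborel) + (\<integral>\<^sup>+x. (\<integral>\<^sup>+y. ?B x y \<partial>lborel) \<partial>lborel)"
    by (subst nn_integral_add[symmetric]) (auto simp: nn_integral_add intro!: nn_integral_cong)
  also have "(\<integral>\<^sup>+x. (\<integral>\<^sup>+y. ?B x y \<partial>lborel) \<partial>lborel) = (\<integral>\<^sup>+y. (\<integral>\<^sup>+x. ?B x y \<partial>lborel) \<partial>lborel)"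
    by (rule lborel_pair.Fubini') measurable
  also have "\<dots> = (\<integral>\<^sup>+y. ennreal ((norm (f y))\<^sup>2 / 2) * ?m \<partial>lborel)"
    by (simp add: nn_integral_cmult gaussian_kernel_nn_integral_translate[OF \<epsilon>])
  also have "(\<integral>\<^sup>+x. (\<integral>\<^sup>+y. ?A x y \<partial>lborel) \<partial>lborel) = (\<integral>\<^sup>+x. ennreal ((norm (f x))\<^sup>2 / 2) * ?m \<partial>lborel)"
    by (simp add: nn_integral_cmult k1)
  finally show ?thesis unfolding half .
qed

text \<open>
  A weighted half of Plancherel's theorem. The left side is the double integral of
  \<open>f(x) f(y)\<^sup>*\<close> against the positive kernel \<open>gaussian_kernel \<epsilon> (x - y)\<close>, to which Schur's test applies. The constant is
  independent of \<open>\<epsilon>\<close>. For \<open>\<epsilon> = 1\<close> the estimate controls Fourier transforms almost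
  everywhere; for small \<open>\<epsilon>\<close> it controls the norms of the approximants constructed later.
\<close>
theorem fourier_bessel:
  fixes f :: "real^'n::finite \<Rightarrow> complex"
  assumes f: "integrable lborel f" and f2: "integrable lborel (\<lambda>x. (norm (f x))\<^sup>2)" and \<epsilon>: "0 < \<epsilon>"
  shows "integrable lborel (\<lambda>u. (norm (fourier f u))\<^sup>2 * gaussian (\<epsilon> *\<^sub>R u))" (is ?int)
    and "(LINT u|lborel. (norm (fourier f u))\<^sup>2 * gaussian (\<epsilon> *\<^sub>R u)) \<le>
      (gaussian_mass TYPE('n))\<^sup>2 * (LINT x|lborel. (norm (f x))\<^sup>2)" (is "?J \<le> _")
proof -
  have [measurable]: "f \<in> borel_measurable borel" using f by auto
  have [measurable]: "cnj \<in> borel_measurable borel"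
    by (intro borel_measurable_continuous_onI continuous_intros)
  define L where "L = (LINT x|lborel. norm (f x))"
  have L: "norm (fourier f u) \<le> L" for u
    unfolding L_def by (rule fourier_norm_le[OF f])
  let ?G = "\<lambda>x::real^'n. complex_of_real (gaussian (\<epsilon> *\<^sub>R x))"
  have Gint: "integrable lborel ?G"
    using \<epsilon> by (intro rapidly_decreasing_integrable rapidly_decreasing_dilate[OF gaussian_rapidly_decreasing]) auto
  let ?h = "\<lambda>u. ?G u * fourier (\<lambda>x. cnj (f x)) (- u)"
  have hL: "norm (?h u) \<le> norm (complex_of_real L * ?G u)" for u
    using mult_right_mono[OF order_trans[OF L[of u] abs_ge_self], of "gaussian (\<epsilon> *\<^sub>R u)"] gaussian_pos[of "\<epsilon> *\<^sub>R u"]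
    by (simp add: norm_mult fourier_cnj mult.commute[of "gaussian _"])
  have hint: "integrable lborel ?h"
    by (rule Bochner_Integration.integrable_bound[OF integrable_mult_right[OF Gint, of "complex_of_real L"]])
      (use hL in auto)
  have sq: "fourier f u * ?h u = complex_of_real ((norm (fourier f u))\<^sup>2 * gaussian (\<epsilon> *\<^sub>R u))" for u
    by (simp add: fourier_cnj complex_norm_square mult_ac del: of_real_power)
  have "integrable lborel (\<lambda>u. fourier f u * ?h u)"
    by (rule Bochner_Integration.integrable_bound[OF integrable_mult_right[OF hint, of "complex_of_real L"]])
      (use L in \<open>auto simp: norm_mult intro!: AE_I2 mult_right_mono order_trans[OF _ abs_ge_self]\<close>)
  from integrable_Re[OF this[unfolded sq]] show ?int
    by (simp only: Re_complex_of_real)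
  have J: "complex_of_real ?J = (LINT x|lborel. f x * fourier ?h x)"
    using fourier_multiplication_formula[OF f hint] unfolding sq by (simp only: integral_complex_of_real)
  have cf: "integrable lborel (\<lambda>x. cnj (f x))" using f by simp
  have "ennreal ?J \<le> (\<integral>\<^sup>+x. ennreal (norm (f x * fourier ?h x)) \<partial>lborel)"
  proof (cases "integrable lborel (\<lambda>x. f x * fourier ?h x)")
    case True
    have "ennreal ?J \<le> ennreal (norm (complex_of_real ?J))"
      by (intro ennreal_leI) simp
    then show ?thesis
      unfolding J using integral_norm_bound_ennreal[OF True] by (rule order_trans)
  next
    case False
    then show ?thesis using J by (simp add: not_integrable_integral_eq)
  qed
  also have "\<dots> \<le> (\<integral>\<^sup>+x. (\<integral>\<^sup>+y. ennreal (norm (f x) * (norm (f y) * gaussian_kernel \<epsilon> (x - y))) \<partial>lborel) \<partial>lborel)"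
  proof (rule nn_integral_mono)
    fix x
    let ?k = "\<lambda>y. cnj (f y) * complex_of_real (gaussian_kernel \<epsilon> (x - y))"
    \<comment> \<open>If \<open>?k\<close> is not integrable, the Bochner integral is 0 and the bound is trivial.\<close>
    have "ennreal (norm (LINT y|lborel. ?k y)) \<le> (\<integral>\<^sup>+y. ennreal (norm (?k y)) \<partial>lborel)"
      by (cases "integrable lborel ?k") (auto simp: integral_norm_bound_ennreal not_integrable_integral_eq)
    from mult_left_mono[OF this, of "ennreal (norm (f x))"]
    show "ennreal (norm (f x * fourier ?h x)) \<le> (\<integral>\<^sup>+y. ennreal (norm (f x) * (norm (f y) * gaussian_kernel \<epsilon> (x - y))) \<partial>lborel)"
      unfolding fourier_gaussian_cutoff[OF cf \<epsilon>]
      by (simp add: norm_mult ennreal_mult nn_integral_cmult abs_of_nonneg gaussian_kernel_nonneg[OF \<epsilon>])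
  qed
  also have "\<dots> \<le> ennreal ((gaussian_mass TYPE('n))\<^sup>2) * (\<integral>\<^sup>+x. ennreal ((norm (f x))\<^sup>2) \<partial>lborel)"
    by (rule gaussian_schur[OF _ \<epsilon>]) simp
  also have "(\<integral>\<^sup>+x. ennreal ((norm (f x))\<^sup>2) \<partial>lborel) = ennreal (LINT x|lborel. (norm (f x))\<^sup>2)"
    by (rule nn_integral_eq_integral[OF f2]) simp
  finally show "?J \<le> (gaussian_mass TYPE('n))\<^sup>2 * (LINT x|lborel. (norm (f x))\<^sup>2)"
    by (simp add: ennreal_mult[symmetric])
qed

section \<open>Schwartz functions with mollified Fourier transform\<close>

text \<open>
  Polynomials times a dilated Gaussian times Fourier transforms of rapidly decreasing functions: a
  class closed under all operations that differentiation produces. Closure under \<open>partial_deriv\<close> and rapid decay of every member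
  together give membership in the Schwartz space without bookkeeping of higher derivatives.
\<close>
inductive gaussian_span :: "real \<Rightarrow> (real^'n::finite \<Rightarrow> complex) \<Rightarrow> bool" for \<epsilon> where
  base: "rapidly_decreasing w \<Longrightarrow>
    gaussian_span \<epsilon> (\<lambda>x. complex_of_real (gaussian (\<epsilon> *\<^sub>R x)) * fourier w (- x))"
| coord: "gaussian_span \<epsilon> f \<Longrightarrow> gaussian_span \<epsilon> (\<lambda>x. complex_of_real (x $ i) * f x)"
| scale: "gaussian_span \<epsilon> f \<Longrightarrow> gaussian_span \<epsilon> (\<lambda>x. c * f x)"
| add: "gaussian_span \<epsilon> f \<Longrightarrow> gaussian_span \<epsilon> g \<Longrightarrow> gaussian_span \<epsilon> (\<lambda>x. f x + g x)"

lemma gaussian_span_rapidly_decreasing: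
  assumes "gaussian_span \<epsilon> f" and \<epsilon>: "\<epsilon> \<noteq> 0"
  shows "rapidly_decreasing f"
  using assms(1)
proof induction
  case (base w)
  have [measurable]: "w \<in> borel_measurable borel"
    using base by measurable
  have bd: "norm (fourier w (- x)) \<le> (LINT x|lborel. norm (w x))" for x
    by (intro fourier_norm_le rapidly_decreasing_integrable base)
  show ?case
    by (rule rapidly_decreasing_dominated[OF rapidly_decreasing_dilate[OF gaussian_rapidly_decreasing \<epsilon>],
          of _ "LINT x|lborel. norm (w x)" 0])
      (use bd in \<open>auto simp: norm_mult mult.commute[of "norm (fourier _ _)"] mult.commute[of "LINT x|lborel. _ x"] intro!: mult_left_mono\<close>)
qed (auto intro: rapidly_decreasing_coord rapidly_decreasing_scale rapidly_decreasing_add)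

lemma gaussian_span_has_derivative:
  assumes "gaussian_span \<epsilon> f"
  shows "\<exists>D. \<forall>x. (f has_derivative D x) (at x) \<and> (\<forall>i. gaussian_span \<epsilon> (\<lambda>x. D x (axis i 1)))"
  using assms
proof induction
  case (base w)
  let ?G = "\<lambda>x. complex_of_real (gaussian (\<epsilon> *\<^sub>R x))"
  let ?w = "\<lambda>i x. - \<i> * (complex_of_real (x $ i) * w x)"
  let ?D = "\<lambda>x h. ?G x * (\<Sum>i\<in>UNIV. complex_of_real ((- h) $ i) * fourier (?w i) (- x)) +
    complex_of_real (- ((\<epsilon> *\<^sub>R x) \<bullet> (\<epsilon> *\<^sub>R h)) * gaussian (\<epsilon> *\<^sub>R x)) * fourier w (- x)"
  have w: "rapidly_decreasing (?w i)" for i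
    by (intro rapidly_decreasing_scale rapidly_decreasing_coord base)
  have "((\<lambda>x. ?G x * fourier w (- x)) has_derivative ?D x) (at x)" for x
  proof (rule has_derivative_mult)
    show "(?G has_derivative (\<lambda>h. complex_of_real (- ((\<epsilon> *\<^sub>R x) \<bullet> (\<epsilon> *\<^sub>R h)) * gaussian (\<epsilon> *\<^sub>R x)))) (at x)"
      by (rule has_derivative_of_real[OF has_derivative_compose[OF _ gaussian_has_derivative]])
        (auto intro!: derivative_eq_intros)
    show "((\<lambda>x. fourier w (- x)) has_derivative (\<lambda>h. \<Sum>i\<in>UNIV. complex_of_real ((- h) $ i) * fourier (?w i) (- x))) (at x)"
      by (rule has_derivative_compose[OF _ fourier_has_derivative[OF base]]) (auto intro!: derivative_eq_intros)
  qed
  moreover have "gaussian_span \<epsilon> (\<lambda>x. ?D x (axis j 1))" for j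
  proof -
    have "(\<Sum>i\<in>UNIV. complex_of_real ((- axis j 1) $ i) * fourier (?w i) (- x)) = - fourier (?w j) (- x)" for x
    proof -
      have "(\<Sum>i\<in>UNIV. complex_of_real ((- axis j 1) $ i) * fourier (?w i) (- x)) =
        (\<Sum>i\<in>UNIV. if i = j then - fourier (?w i) (- x) else 0)"
        by (intro sum.cong) (auto simp: axis_def)
      then show ?thesis by simp
    qed
    then have "(\<lambda>x. ?D x (axis j 1)) = (\<lambda>x. - 1 * (?G x * fourier (?w j) (- x)) +
       complex_of_real (- \<epsilon>\<^sup>2) * (complex_of_real (x $ j) * (?G x * fourier w (- x))))"
      by (auto simp: fun_eq_iff inner_axis power2_eq_square mult_ac)
    then show ?thesis
      by (simp only:) (intro gaussian_span.intros w base)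
  qed
  ultimately show ?case by (intro exI[of _ ?D] allI conjI)
next
  case (coord f j)
  then obtain D where D: "\<And>x. (f has_derivative D x) (at x)" "\<And>i. gaussian_span \<epsilon> (\<lambda>x. D x (axis i 1))"
    by blast
  let ?D = "\<lambda>x h. complex_of_real (x $ j) * D x h + complex_of_real (h $ j) * f x"
  have "((\<lambda>x. complex_of_real (x $ j) * f x) has_derivative ?D x) (at x)" for x
    by (intro has_derivative_mult has_derivative_of_real D bounded_linear_imp_has_derivative bounded_linear_vec_nth)
  moreover have "gaussian_span \<epsilon> (\<lambda>x. ?D x (axis i 1))" for i
    by (intro gaussian_span.intros D coord)
  ultimately show ?case by (intro exI[of _ ?D] allI conjI)
next
  case (scale f c)
  then obtain D where D: "\<And>x. (f has_derivative D x) (at x)" "\<And>i. gaussian_span \<epsilon> (\<lambda>x. D x (axis i 1))"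
    by blast
  have "((\<lambda>x. c * f x) has_derivative (\<lambda>h. c * D x h)) (at x)" for x
    by (intro has_derivative_mult_right D)
  moreover have "gaussian_span \<epsilon> (\<lambda>x. c * D x (axis i 1))" for i
    by (intro gaussian_span.intros D)
  ultimately show ?case by (intro exI[of _ "\<lambda>x h. c * D x h"] allI conjI)
next
  case (add f g)
  then obtain D E where D: "\<And>x. (f has_derivative D x) (at x)" "\<And>i. gaussian_span \<epsilon> (\<lambda>x. D x (axis i 1))"
    "\<And>x. (g has_derivative E x) (at x)" "\<And>i. gaussian_span \<epsilon> (\<lambda>x. E x (axis i 1))"
    by blast
  have "((\<lambda>x. f x + g x) has_derivative (\<lambda>h. D x h + E x h)) (at x)" for x
    by (intro has_derivative_add D)
  moreover have "gaussian_span \<epsilon> (\<lambda>x. D x (axis i 1) + E x (axis i 1))" for i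
    by (intro gaussian_span.intros D)
  ultimately show ?case by (intro exI[of _ "\<lambda>x h. D x h + E x h"] allI conjI)
qed

lemma gaussian_span_partial_deriv:
  assumes "gaussian_span \<epsilon> f"
  shows "gaussian_span \<epsilon> (partial_deriv i f)"
proof -
  obtain D where D: "\<And>x. (f has_derivative D x) (at x)" "\<And>i. gaussian_span \<epsilon> (\<lambda>x. D x (axis i 1))"
    using gaussian_span_has_derivative[OF assms] by blast
  have "partial_deriv i f = (\<lambda>x. D x (axis i 1))"
    by (intro ext partial_deriv_eqI D)
  with D show ?thesis by simp
qed

lemma gaussian_span_schwartz:
  assumes f: "gaussian_span \<epsilon> f" and \<epsilon>: "\<epsilon> \<noteq> 0"
  shows "f \<in> schwartz_space"
proof -
  have "gaussian_span \<epsilon> (iter_partial_deriv is f)" for "is"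
    by (induction "is") (auto simp: iter_partial_deriv_def f intro: gaussian_span_partial_deriv)
  then show ?thesis
    unfolding schwartz_space_iff
    using gaussian_span_has_derivative gaussian_span_rapidly_decreasing[OF _ \<epsilon>]
    by (meson differentiable_def)
qed

text \<open>
  Convolution of \<open>w\<close> with the Gaussian probability density of scale \<open>\<epsilon>\<close>, after substituting the
  scaled variable.
\<close>
definition mollify :: "real \<Rightarrow> (real^'n::finite \<Rightarrow> real) \<Rightarrow> real^'n \<Rightarrow> real" where
  "mollify \<epsilon> w u = (LINT z|lborel. w (u - \<epsilon> *\<^sub>R z) * gaussian z) / gaussian_mass TYPE('n)"

text \<open>
  The function whose Fourier transform is \<open>mollify \<epsilon> w\<close>: up to a constant, the inverse Fourier
  transform of \<open>w\<close> cut off by a Gaussian. The square of \<open>gaussian_mass\<close> is the constant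
  \<open>(2 \<pi>)\<^sup>n\<close> of Fourier inversion.
\<close>
definition mollify_preimage :: "real \<Rightarrow> (real^'n::finite \<Rightarrow> real) \<Rightarrow> real^'n \<Rightarrow> complex" where
  "mollify_preimage \<epsilon> w x = complex_of_real (1 / (gaussian_mass TYPE('n))\<^sup>2) *
     (complex_of_real (gaussian (\<epsilon> *\<^sub>R x)) * fourier (\<lambda>x. complex_of_real (w x)) (- x))"

lemma mollify_preimage_schwartz:
  assumes "rapidly_decreasing (\<lambda>x. complex_of_real (w x))" "\<epsilon> \<noteq> 0"
  shows "mollify_preimage \<epsilon> w \<in> schwartz_space"
  unfolding mollify_preimage_def[abs_def]
  by (rule gaussian_span_schwartz[OF _ assms(2)]) (intro gaussian_span.intros assms)

lemma fourier_mollify_preimage: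
  fixes w :: "real^'n::finite \<Rightarrow> real"
  assumes w: "rapidly_decreasing (\<lambda>x. complex_of_real (w x))" and \<epsilon>: "0 < \<epsilon>"
  shows "fourier (mollify_preimage \<epsilon> w) u = complex_of_real (mollify \<epsilon> w u)"
proof -
  let ?I = "gaussian_mass TYPE('n)"
  have I: "?I > 0" by (rule gaussian_mass_pos)
  have "(\<lambda>x. Re (complex_of_real (w x))) \<in> borel_measurable borel"
    using rapidly_decreasing_measurable[OF w] by measurable
  then have [measurable]: "w \<in> borel_measurable borel" by simp
  have "fourier (mollify_preimage \<epsilon> w) u = complex_of_real (1 / ?I\<^sup>2) *
     (LINT v|lborel. complex_of_real (w v) * complex_of_real (gaussian_kernel \<epsilon> (u - v)))"
    unfolding mollify_preimage_def[abs_def] fourier_scale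
    by (simp only: fourier_gaussian_cutoff[OF rapidly_decreasing_integrable[OF w] \<epsilon>])
  also have "(LINT v|lborel. complex_of_real (w v) * complex_of_real (gaussian_kernel \<epsilon> (u - v))) =
     complex_of_real (LINT v|lborel. w v * gaussian_kernel \<epsilon> (u - v))"
    by (simp only: of_real_mult[symmetric] integral_complex_of_real)
  also have "(LINT v|lborel. w v * gaussian_kernel \<epsilon> (u - v)) =
     \<bar>- \<epsilon>\<bar> ^ CARD('n) *\<^sub>R (LINT z|lborel. w (u + (- \<epsilon>) *\<^sub>R z) * gaussian_kernel \<epsilon> (u - (u + (- \<epsilon>) *\<^sub>R z)))"
    using \<epsilon> by (intro lborel_integral_affine) auto
  also have "\<dots> = \<epsilon> ^ CARD('n) * (LINT z|lborel. ?I / \<epsilon> ^ CARD('n) * (w (u - \<epsilon> *\<^sub>R z) * gaussian z))"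
    using \<epsilon> by (simp add: gaussian_kernel_def mult_ac)
  also have "\<dots> = ?I * (LINT z|lborel. w (u - \<epsilon> *\<^sub>R z) * gaussian z)"
    using \<epsilon> by (subst integral_mult_right_zero) simp
  finally show ?thesis
    using I by (simp add: mollify_def power2_eq_square)
qed

lemma rapidly_decreasing_norm_square_integrable:
  fixes f :: "real^'n::finite \<Rightarrow> complex"
  assumes f: "rapidly_decreasing f"
  shows "integrable lborel (\<lambda>x. (norm (f x))\<^sup>2)"
proof -
  have [measurable]: "f \<in> borel_measurable borel"
    using f by measurable
  obtain C where C: "\<And>x. (1 + (norm x)\<^sup>2) ^ 0 * norm (f x) \<le> C"
    using rapidly_decreasingE[OF f] by metis
  show ?thesis
    by (rule Bochner_Integration.integrable_bound[OF integrable_mult_right[OF integrable_norm[OF rapidly_decreasing_integrable[OF f]], of C]])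
      (use C in \<open>auto simp: power2_eq_square abs_mult intro!: mult_right_mono order_trans[OF _ abs_ge_self]\<close>)
qed

text \<open>
  The squared norm contains the square of the Gaussian cutoff; since the cutoff is at most 1, one factor may be
  dropped, and the Bessel inequality then applies to \<open>w\<close> with a constant that is independent of \<open>\<epsilon>\<close>.
\<close>
lemma L2_norm_mollify_preimage_le:
  fixes w :: "real^'n::finite \<Rightarrow> real"
  assumes w: "rapidly_decreasing (\<lambda>x. complex_of_real (w x))" and \<epsilon>: "0 < \<epsilon>"
  shows "L2_norm (mollify_preimage \<epsilon> w) \<le> sqrt ((LINT x|lborel. (w x)\<^sup>2) / (gaussian_mass TYPE('n))\<^sup>2)"
proof -
  let ?I = "gaussian_mass TYPE('n)"
  have I: "?I > 0" by (rule gaussian_mass_pos)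
  let ?W = "\<lambda>x. complex_of_real (w x)"
  have [measurable]: "?W \<in> borel_measurable borel"
    using w by measurable
  note B = fourier_bessel[OF rapidly_decreasing_integrable[OF w] rapidly_decreasing_norm_square_integrable[OF w] \<epsilon>]
  have "(LINT x|lborel. (norm (mollify_preimage \<epsilon> w x))\<^sup>2) =
      (LINT x|lborel. (norm (mollify_preimage \<epsilon> w (- x)))\<^sup>2)"
    unfolding mollify_preimage_def[abs_def]
    by (subst lborel_integral_affine[where c="-1" and t=0]) auto
  also have "\<dots> \<le> (LINT x|lborel. 1 / ?I ^ 4 * ((norm (fourier ?W x))\<^sup>2 * gaussian (\<epsilon> *\<^sub>R x)))"
  proof (rule integral_mono')
    show "integrable lborel (\<lambda>x. 1 / ?I ^ 4 * ((norm (fourier ?W x))\<^sup>2 * gaussian (\<epsilon> *\<^sub>R x)))"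
      by (intro integrable_mult_right B)
    fix x
    have "(norm (mollify_preimage \<epsilon> w (- x)))\<^sup>2 = 1 / ?I ^ 4 * ((norm (fourier ?W x))\<^sup>2 * (gaussian (\<epsilon> *\<^sub>R x))\<^sup>2)"
      using I by (simp add: mollify_preimage_def norm_mult power_mult_distrib norm_divide norm_power power_divide)
    also have "\<dots> \<le> 1 / ?I ^ 4 * ((norm (fourier ?W x))\<^sup>2 * gaussian (\<epsilon> *\<^sub>R x))"
      using gaussian_pos[of "\<epsilon> *\<^sub>R x"] gaussian_le_1[of "\<epsilon> *\<^sub>R x"]
      by (intro mult_left_mono) (auto simp: power2_eq_square mult_left_le_one_le)
    finally show "(norm (mollify_preimage \<epsilon> w (- x)))\<^sup>2 \<le> 1 / ?I ^ 4 * ((norm (fourier ?W x))\<^sup>2 * gaussian (\<epsilon> *\<^sub>R x))" .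
  qed (use I in \<open>auto intro!: divide_nonneg_pos mult_nonneg_nonneg less_imp_le[OF gaussian_pos]\<close>)
  also have "\<dots> \<le> 1 / ?I ^ 4 * (?I\<^sup>2 * (LINT x|lborel. (norm (?W x))\<^sup>2))"
    unfolding integral_mult_right_zero by (intro mult_left_mono B(2)) auto
  also have "\<dots> = (LINT x|lborel. (w x)\<^sup>2) / ?I\<^sup>2"
    using I by (simp add: field_simps power2_eq_square power4_eq_xxxx)
  finally show ?thesis
    unfolding L2_norm_def by (rule real_sqrt_le_mono)
qed

section \<open>Quantitative mollification\<close>

lemma mollify_minus_le:
  fixes w :: "real^'n::finite \<Rightarrow> real"
  assumes [measurable]: "w \<in> borel_measurable borel"
    and w01: "\<And>x. 0 \<le> w x" "\<And>x. w x \<le> 1"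
    and lip: "\<And>x y. \<bar>w x - w y\<bar> \<le> L * norm (x - y)" and \<epsilon>: "0 < \<epsilon>"
  shows "\<bar>mollify \<epsilon> w u - w u\<bar> \<le> L * \<epsilon> * ((LINT z|lborel. norm (z :: real^'n) * gaussian z) / gaussian_mass TYPE('n))"
proof -
  let ?I = "gaussian_mass TYPE('n)"
  have I: "?I > 0" by (rule gaussian_mass_pos)
  have int: "integrable lborel (\<lambda>z. w (u - \<epsilon> *\<^sub>R z) * gaussian z)"
    by (rule Bochner_Integration.integrable_bound[OF gaussian_integrable])
      (use w01 in \<open>auto simp: abs_mult abs_of_pos[OF gaussian_pos] intro!: mult_left_le_one_le less_imp_le[OF gaussian_pos]\<close>)
  have "rapidly_decreasing (\<lambda>z::real^'n. complex_of_real (norm z * gaussian z))"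
    by (rule rapidly_decreasing_dominated[OF gaussian_rapidly_decreasing, of _ 1 1])
      (auto simp: norm_mult abs_of_pos[OF gaussian_pos] intro!: mult_right_mono norm_le_one_plus_square less_imp_le[OF gaussian_pos])
  from integrable_Re[OF rapidly_decreasing_integrable[OF this]]
  have int1: "integrable lborel (\<lambda>z::real^'n. norm z * gaussian z)" by simp
  have "mollify \<epsilon> w u - w u = (LINT z|lborel. w (u - \<epsilon> *\<^sub>R z) * gaussian z - w u * gaussian z) / ?I"
    using I by (subst Bochner_Integration.integral_diff[OF int integrable_mult_right[OF gaussian_integrable]])
      (simp add: mollify_def gaussian_mass_def[symmetric] field_simps)
  also have "\<bar>\<dots>\<bar> \<le> (LINT z|lborel. L * \<epsilon> * (norm (z :: real^'n) * gaussian z)) / ?I"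
  proof -
    have "norm (LINT z|lborel. w (u - \<epsilon> *\<^sub>R z) * gaussian z - w u * gaussian z) \<le>
       (LINT z|lborel. L * \<epsilon> * (norm (z :: real^'n) * gaussian z))"
    proof (rule Bochner_Integration.integral_norm_bound_integral)
      show "integrable lborel (\<lambda>z. w (u - \<epsilon> *\<^sub>R z) * gaussian z - w u * gaussian z)"
        by (intro Bochner_Integration.integrable_diff int integrable_mult_right gaussian_integrable)
      show "integrable lborel (\<lambda>z::real^'n. L * \<epsilon> * (norm z * gaussian z))"
        by (intro integrable_mult_right int1)
      fix z :: "real^'n"
      have "\<bar>w (u - \<epsilon> *\<^sub>R z) - w u\<bar> \<le> L * \<epsilon> * norm z"
        using lip[of "u - \<epsilon> *\<^sub>R z" u] \<epsilon> by (simp add: mult.assoc)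
      from mult_right_mono[OF this less_imp_le[OF gaussian_pos[of z]]]
      show "norm (w (u - \<epsilon> *\<^sub>R z) * gaussian z - w u * gaussian z) \<le> L * \<epsilon> * (norm z * gaussian z)"
        by (simp add: left_diff_distrib[symmetric] abs_mult abs_of_pos[OF gaussian_pos] mult.assoc)
    qed
    then show ?thesis
      using I by (simp add: divide_right_mono abs_divide)
  qed
  finally show ?thesis by simp
qed

lemma mollify_nonneg: "(\<And>x. 0 \<le> w x) \<Longrightarrow> 0 \<le> mollify \<epsilon> w u"
  unfolding mollify_def
  by (intro divide_nonneg_pos gaussian_mass_pos integral_nonneg_AE AE_I2 mult_nonneg_nonneg less_imp_le[OF gaussian_pos])

text \<open>
  Mollifying at scale at most 1 a function with values in \<open>[0, 1]\<close> and support in a fixed ball gives polynomial decay of any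
  order, uniformly in the function and the scale: by Peetre's inequality the weight at \<open>u\<close> is
  absorbed by the Gaussian. This is the domination needed to integrate mollified cutoffs against a measure
  of polynomial growth.
\<close>
lemma mollify_le_weight:
  fixes R :: real
  shows "\<exists>C\<ge>0. \<forall>w \<epsilon> u. w \<in> borel_measurable borel \<longrightarrow> (\<forall>x. 0 \<le> w x \<and> w x \<le> 1) \<longrightarrow> (\<forall>x. R < norm x \<longrightarrow> w x = 0)
      \<longrightarrow> 0 < \<epsilon> \<longrightarrow> \<epsilon> \<le> 1 \<longrightarrow> mollify \<epsilon> w (u :: real^'n::finite) \<le> C * (1 / (1 + (norm u)\<^sup>2) ^ p)"
proof -
  let ?I = "gaussian_mass TYPE('n)"
  have I: "?I > 0" by (rule gaussian_mass_pos)
  define B where "B z = (2 * (1 + R\<^sup>2) * (1 + (norm (z :: real^'n))\<^sup>2)) ^ p" for z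
  have B0: "0 \<le> B z" for z by (simp add: B_def)
  have [measurable]: "B \<in> borel_measurable borel" unfolding B_def[abs_def] by measurable
  have "rapidly_decreasing (\<lambda>z::real^'n. complex_of_real (B z * gaussian z))"
  proof (rule rapidly_decreasing_dominated[OF gaussian_rapidly_decreasing, of _ "(2 * (1 + R\<^sup>2)) ^ p" p])
    show "norm (complex_of_real (B z * gaussian z)) \<le>
        (2 * (1 + R\<^sup>2)) ^ p * (1 + (norm z)\<^sup>2) ^ p * norm (complex_of_real (gaussian z))" for z
      unfolding norm_of_real by (simp add: abs_mult B_def power_mult_distrib)
  qed measurable
  from integrable_Re[OF rapidly_decreasing_integrable[OF this]]
  have int: "integrable lborel (\<lambda>z. B z * gaussian z)" by simp
  define C where "C = (LINT z|lborel. B z * gaussian z) / ?I"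
  have "0 \<le> C"
    unfolding C_def using I B0
    by (intro divide_nonneg_pos integral_nonneg_AE AE_I2 mult_nonneg_nonneg less_imp_le[OF gaussian_pos]) auto
  moreover have "mollify \<epsilon> w u \<le> C * (1 / (1 + (norm u)\<^sup>2) ^ p)"
    if [measurable]: "w \<in> borel_measurable borel" and w01: "\<And>x. 0 \<le> w x" "\<And>x. w x \<le> 1"
      and supp: "\<And>x. R < norm x \<Longrightarrow> w x = 0" and \<epsilon>: "0 < \<epsilon>" "\<epsilon> \<le> 1"
    for w \<epsilon> and u :: "real^'n"
  proof -
    have le: "(1 + (norm u)\<^sup>2) ^ p * w (u - \<epsilon> *\<^sub>R z) \<le> B z" for z
    proof (cases "norm (u - \<epsilon> *\<^sub>R z) \<le> R")
      case True
      have "1 + (norm u)\<^sup>2 \<le> 2 * (1 + (norm (u - \<epsilon> *\<^sub>R z))\<^sup>2) * (1 + (norm (\<epsilon> *\<^sub>R z))\<^sup>2)"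
        using peetre_inequality[of "u - \<epsilon> *\<^sub>R z" "\<epsilon> *\<^sub>R z"] by simp
      also have "\<dots> \<le> 2 * (1 + R\<^sup>2) * (1 + (norm z)\<^sup>2)"
      proof (intro mult_mono add_mono order_refl power_mono True)
        show "norm (\<epsilon> *\<^sub>R z) \<le> norm z"
          using \<epsilon> by (simp add: mult_left_le_one_le)
      qed auto
      finally have "(1 + (norm u)\<^sup>2) ^ p \<le> B z"
        unfolding B_def by (intro power_mono) auto
      moreover have "(1 + (norm u)\<^sup>2) ^ p * w (u - \<epsilon> *\<^sub>R z) \<le> (1 + (norm u)\<^sup>2) ^ p * 1"
        by (intro mult_left_mono w01) auto
      ultimately show ?thesis by simp
    next
      case False
      then show ?thesis using supp[of "u - \<epsilon> *\<^sub>R z"] B0 by simp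
    qed
    have "(1 + (norm u)\<^sup>2) ^ p * (LINT z|lborel. w (u - \<epsilon> *\<^sub>R z) * gaussian z) =
       (LINT z|lborel. (1 + (norm u)\<^sup>2) ^ p * w (u - \<epsilon> *\<^sub>R z) * gaussian z)"
      by (subst integral_mult_right_zero[symmetric]) (simp add: mult.assoc)
    also have "\<dots> \<le> (LINT z|lborel. B z * gaussian z)"
      using le B0 by (intro integral_mono' int mult_right_mono mult_nonneg_nonneg less_imp_le[OF gaussian_pos]) auto
    finally have "(1 + (norm u)\<^sup>2) ^ p * mollify \<epsilon> w u \<le> C"
      using I by (simp add: mollify_def C_def divide_right_mono)
    then show ?thesis
      using weight_denominator_pos[of u p] by (simp add: pos_le_divide_eq mult.commute)
  qed
  ultimately show ?thesis by auto
qed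

section \<open>Cutoffs of compact sets\<close>

text \<open>
  A Lipschitz cutoff equal to 1 on \<open>K\<close> and vanishing at distance at least \<open>1 / (k + 1)\<close> from \<open>K\<close>. The Lipschitz
  bound makes the mollification error explicit; smoothness comes from the mollification.
\<close>
definition tent :: "(real^'n::finite) set \<Rightarrow> nat \<Rightarrow> real^'n \<Rightarrow> real" where
  "tent K k v = max 0 (1 - real (Suc k) * infdist v K)"

lemma tent_measurable [measurable]: "tent K k \<in> borel_measurable borel"
  unfolding tent_def[abs_def] by (intro borel_measurable_continuous_onI continuous_intros)

lemma tent_nonneg: "0 \<le> tent K k v"
  by (simp add: tent_def)

lemma tent_le_1: "tent K k v \<le> 1"
  using infdist_nonneg[of v K] by (simp add: tent_def)

lemma tent_lipschitz: "\<bar>tent K k x - tent K k y\<bar> \<le> real (Suc k) * norm (x - y)"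
proof -
  have "\<bar>infdist x K - infdist y K\<bar> \<le> norm (x - y)"
    using infdist_triangle_abs[of x K y] by (simp add: dist_norm)
  then have "real (Suc k) * \<bar>infdist x K - infdist y K\<bar> \<le> real (Suc k) * norm (x - y)"
    by (rule mult_left_mono) simp
  moreover have "c * \<bar>a - b\<bar> = \<bar>c * a - c * b\<bar>" if "0 \<le> c" for a b c :: real
    using that by (simp add: right_diff_distrib[symmetric] abs_mult)
  ultimately have "\<bar>real (Suc k) * infdist x K - real (Suc k) * infdist y K\<bar> \<le> real (Suc k) * norm (x - y)"
    by (metis of_nat_0_le_iff)
  then show ?thesis unfolding tent_def by linarith
qed

lemma tent_tendsto_indicator:
  assumes K: "closed K" "K \<noteq> {}"
  shows "(\<lambda>k. tent K k u) \<longlonglongrightarrow> indicator K u"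
proof (cases "u \<in> K")
  case True
  then show ?thesis by (simp add: tent_def infdist_zero)
next
  case False
  then have d: "0 < infdist u K"
    using K in_closed_iff_infdist_zero[OF K, of u] infdist_nonneg[of u K] by simp
  obtain N :: nat where N: "1 / infdist u K < real N"
    using reals_Archimedean2 by blast
  have "tent K k u = 0" if "N \<le> k" for k
  proof -
    \<comment> \<open>From \<open>N\<close> on, \<open>u\<close> lies outside the support of the tent.\<close>
    have "1 / infdist u K \<le> real (Suc k)" using N that by simp
    then show ?thesis using d by (simp add: tent_def field_simps)
  qed
  then have "\<forall>\<^sub>F k in sequentially. tent K k u = 0"
    by (auto simp: eventually_sequentially)
  then show ?thesis using False by (simp add: tendsto_eventually)
qed

lemma tent_supported:
  assumes K: "K \<noteq> {}" "\<And>x. x \<in> K \<Longrightarrow> norm x \<le> r" and v: "r + 1 < norm v"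
  shows "tent K k v = 0"
proof -
  have "1 \<le> infdist v K"
    unfolding infdist_notempty[OF K(1)]
  proof (rule cINF_greatest[OF K(1)])
    fix a assume "a \<in> K"
    with K(2)[of a] v norm_triangle_ineq2[of v a] show "1 \<le> dist v a"
      by (simp add: dist_norm)
  qed
  then have "1 * 1 \<le> real (Suc k) * infdist v K" by (intro mult_mono) auto
  then show ?thesis by (simp add: tent_def)
qed

lemma tent_rapidly_decreasing:
  fixes K :: "(real^'n::finite) set"
  assumes K: "K \<noteq> {}" "\<And>x. x \<in> K \<Longrightarrow> norm x \<le> r"
  shows "rapidly_decreasing (\<lambda>x. complex_of_real (tent K k x))"
  unfolding rapidly_decreasing_def
proof (intro conjI allI)
  fix p
  have "(1 + (norm x)\<^sup>2) ^ p * norm (complex_of_real (tent K k x)) \<le> (1 + (r + 1)\<^sup>2) ^ p" for x :: "real^'n"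
  proof (cases "norm x \<le> r + 1")
    case True
    then have "(1 + (norm x)\<^sup>2) ^ p * \<bar>tent K k x\<bar> \<le> (1 + (r + 1)\<^sup>2) ^ p * 1"
      using tent_le_1[of K k x] tent_nonneg[of K k x] by (intro mult_mono power_mono add_mono) auto
    then show ?thesis by simp
  next
    case False
    then show ?thesis using tent_supported[OF K, of x k] by simp
  qed
  then show "\<exists>C. \<forall>x. (1 + (norm x)\<^sup>2) ^ p * norm (complex_of_real (tent K k x)) \<le> C" by blast
qed measurable

section \<open>Closability of the spectral form\<close>

lemma tempered_measureE:
  fixes \<sigma> :: "(real^'n::finite) measure"
  assumes "\<sigma> \<in> tempered_measures"
  obtains p where "integrable \<sigma> (\<lambda>u. 1 / (1 + (norm u)\<^sup>2) ^ p)"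
proof -
  have [measurable_cong]: "sets \<sigma> = sets borel"
    using assms by (simp add: tempered_measures_def regular_borel_measure_def)
  obtain p where p: "(\<integral>\<^sup>+u. ennreal (1 / (1 + (norm u)\<^sup>2) ^ p) \<partial>\<sigma>) < \<infinity>"
    using assms by (auto simp: tempered_measures_def)
  have "integrable \<sigma> (\<lambda>u. 1 / (1 + (norm u)\<^sup>2) ^ p)"
    by (rule integrableI_bounded) (use p in auto)
  then show thesis by (rule that)
qed

lemma tempered_measure_sets: "\<sigma> \<in> tempered_measures \<Longrightarrow> sets \<sigma> = sets borel"
  by (simp add: tempered_measures_def regular_borel_measure_def)

lemma rapidly_decreasing_square_integrable_tempered:
  fixes g :: "real^'n::finite \<Rightarrow> complex"
  assumes \<sigma>: "\<sigma> \<in> tempered_measures" and g: "rapidly_decreasing g"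
  shows "integrable \<sigma> (\<lambda>u. (norm (g u))\<^sup>2)"
proof -
  note [measurable_cong] = tempered_measure_sets[OF \<sigma>]
  have [measurable]: "g \<in> borel_measurable borel"
    using g by measurable
  obtain p where p: "integrable \<sigma> (\<lambda>u. 1 / (1 + (norm u)\<^sup>2) ^ p)"
    using tempered_measureE[OF \<sigma>] .
  obtain C where C: "C \<ge> 0" "\<And>x. norm (g x) \<le> C * (1 / (1 + (norm x)\<^sup>2) ^ p)"
    using rapidly_decreasing_le_weight[OF g] by metis
  obtain D where D: "\<And>x. (1 + (norm x)\<^sup>2) ^ 0 * norm (g x) \<le> D"
    using rapidly_decreasingE[OF g] by metis
  have le: "(norm (g x))\<^sup>2 \<le> D * (C * (1 / (1 + (norm x)\<^sup>2) ^ p))" for x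
    unfolding power2_eq_square[of "norm (g x)"] using D[of x] C(2)[of x] order_trans[OF norm_ge_zero, of "g x" D]
    by (intro mult_mono) auto
  show ?thesis
  proof (rule Bochner_Integration.integrable_bound[OF integrable_mult_right[OF integrable_mult_right[OF p, of C], of D]])
    show "AE x in \<sigma>. norm ((norm (g x))\<^sup>2) \<le> norm (D * (C * (1 / (1 + (norm x)\<^sup>2) ^ p)))"
      unfolding real_norm_def abs_power2 by (intro AE_I2 order_trans[OF le abs_ge_self])
  qed measurable
qed

text \<open>
  By the Bessel inequality with \<open>\<epsilon> = 1\<close>, the Fourier transforms tend to 0 in the space of square integrable functions for the
  Gaussian measure, hence along a subsequence almost everywhere. Absolute continuity turns this
  into convergence \<open>\<sigma>\<close>-almost everywhere, and Fatou's lemma along this subsequence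
  bounds \<open>spectral_form \<sigma> (s k)\<close> by the lower limit of \<open>spectral_form \<sigma> (s k - s l)\<close>,
  which is small by the Cauchy condition.
\<close>
lemma closable_if_absolutely_continuous:
  fixes \<sigma> :: "(real^'n::finite) measure"
  assumes \<sigma>: "\<sigma> \<in> tempered_measures" and ac: "absolutely_continuous lborel \<sigma>"
  shows "closable (spectral_form \<sigma>)"
  unfolding closable_def
proof (intro allI impI)
  fix s :: "nat \<Rightarrow> real^'n \<Rightarrow> complex"
  assume s: "\<forall>k. s k \<in> schwartz_space" and L2: "(\<lambda>k. L2_norm (s k)) \<longlonglongrightarrow> 0"
    and cauchy: "((\<lambda>(k, l). spectral_form \<sigma> (\<lambda>x. s k x - s l x)) \<longlongrightarrow> 0) (sequentially \<times>\<^sub>F sequentially)"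
  note [measurable_cong] = tempered_measure_sets[OF \<sigma>]
  have rs: "rapidly_decreasing (s k)" for k
    using s by (simp add: schwartz_space_rapidly_decreasing)
  have rF: "rapidly_decreasing (fourier (s k))" for k
    using s by (simp add: fourier_schwartz_rapidly_decreasing)
  have [measurable]: "fourier (s k) \<in> borel_measurable borel" for k
    using rF[of k] by measurable
  let ?I = "gaussian_mass TYPE('n)"
  let ?q = "\<lambda>k l. spectral_form \<sigma> (\<lambda>x. s k x - s l x)"
  have diff: "rapidly_decreasing (\<lambda>u. fourier (s k) u - fourier (s l) u)" for k l
    using rapidly_decreasing_add[OF rF[of k] rapidly_decreasing_scale[OF rF[of l], of "-1"]] by simp
  have q: "(\<integral>\<^sup>+u. ennreal ((norm (fourier (s k) u - fourier (s l) u))\<^sup>2) \<partial>\<sigma>) = ennreal (?q k l)" for k l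
    unfolding spectral_form_def fourier_diff[OF rapidly_decreasing_integrable[OF rs] rapidly_decreasing_integrable[OF rs]]
    by (intro nn_integral_eq_integral rapidly_decreasing_square_integrable_tempered[OF \<sigma>] diff) auto
  have q1: "(\<integral>\<^sup>+u. ennreal ((norm (fourier (s k) u))\<^sup>2) \<partial>\<sigma>) = ennreal (spectral_form \<sigma> (s k))" for k
    unfolding spectral_form_def
    by (intro nn_integral_eq_integral rapidly_decreasing_square_integrable_tempered[OF \<sigma>] rF) auto
  note B = fourier_bessel[OF rapidly_decreasing_integrable[OF rs] rapidly_decreasing_norm_square_integrable[OF rs] zero_less_one, simplified]
  have "\<exists>r::nat\<Rightarrow>nat. strict_mono r \<and> (AE u in lborel. (\<lambda>j. (norm (fourier (s (r j)) u))\<^sup>2 * gaussian u) \<longlonglongrightarrow> 0)"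
  proof (rule tendsto_L1_AE_subseq)
    show "integrable lborel (\<lambda>u. (norm (fourier (s k) u))\<^sup>2 * gaussian u)" for k
      by (rule B)
    have L2': "(L2_norm (s k))\<^sup>2 = (LINT x|lborel. (norm (s k x))\<^sup>2)" for k
      unfolding L2_norm_def by (simp add: integral_nonneg_AE)
    show "(\<lambda>k. LINT u|lborel. norm ((norm (fourier (s k) u))\<^sup>2 * gaussian u)) \<longlonglongrightarrow> 0"
    proof (rule tendsto_sandwich[OF _ _ tendsto_const])
      show "(\<lambda>k. ?I\<^sup>2 * (L2_norm (s k))\<^sup>2) \<longlonglongrightarrow> 0"
        using L2 by (auto intro!: tendsto_eq_intros)
      show "\<forall>\<^sub>F k in sequentially. (LINT u|lborel. norm ((norm (fourier (s k) u))\<^sup>2 * gaussian u)) \<le> ?I\<^sup>2 * (L2_norm (s k))\<^sup>2"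
        using B(2) by (simp add: L2' abs_mult abs_of_pos[OF gaussian_pos])
    qed (simp add: integral_nonneg_AE)
  qed
  then obtain r where r: "strict_mono r"
    and AEl: "AE u in lborel. (\<lambda>j. (norm (fourier (s (r j)) u))\<^sup>2 * gaussian u) \<longlonglongrightarrow> 0" by blast
  have "AE u in lborel. (\<lambda>j. fourier (s (r j)) u) \<longlonglongrightarrow> 0"
    using AEl
  proof eventually_elim
    fix u :: "real^'n"
    assume "(\<lambda>j. (norm (fourier (s (r j)) u))\<^sup>2 * gaussian u) \<longlonglongrightarrow> 0"
    from tendsto_real_sqrt[OF tendsto_divide[OF this tendsto_const[of "gaussian u"]]]
    have "(\<lambda>j. norm (fourier (s (r j)) u)) \<longlonglongrightarrow> 0"
      using gaussian_pos[of u] by simp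
    then show "(\<lambda>j. fourier (s (r j)) u) \<longlonglongrightarrow> 0"
      by (simp add: tendsto_norm_zero_iff)
  qed
  then have AE\<sigma>: "AE u in \<sigma>. (\<lambda>j. fourier (s (r j)) u) \<longlonglongrightarrow> 0"
    by (rule absolutely_continuous_AE[rotated 2]) (use ac tempered_measure_sets[OF \<sigma>] in auto)
  show "(\<lambda>k. spectral_form \<sigma> (s k)) \<longlonglongrightarrow> 0"
  proof (rule LIMSEQ_I)
    fix e :: real assume e: "0 < e"
    have "\<forall>\<^sub>F (k, l) in sequentially \<times>\<^sub>F sequentially. dist (?q k l) 0 < e / 2"
      using tendstoD[OF cauchy, of "e / 2"] e by (simp add: case_prod_beta')
    then obtain N where N: "\<And>k l. N \<le> k \<Longrightarrow> N \<le> l \<Longrightarrow> \<bar>?q k l\<bar> < e / 2"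
      by (auto simp: eventually_prod_sequentially)
    have "norm (spectral_form \<sigma> (s k) - 0) < e" if k: "N \<le> k" for k
    proof -
      have "ennreal (spectral_form \<sigma> (s k)) = (\<integral>\<^sup>+u. ennreal ((norm (fourier (s k) u))\<^sup>2) \<partial>\<sigma>)"
        by (rule q1[symmetric])
      also have "\<dots> = (\<integral>\<^sup>+u. liminf (\<lambda>j. ennreal ((norm (fourier (s k) u - fourier (s (r j)) u))\<^sup>2)) \<partial>\<sigma>)"
      proof (rule nn_integral_cong_AE, use AE\<sigma> in eventually_elim)
        fix u assume "(\<lambda>j. fourier (s (r j)) u) \<longlonglongrightarrow> 0"
        then have "(\<lambda>j. ennreal ((norm (fourier (s k) u - fourier (s (r j)) u))\<^sup>2)) \<longlonglongrightarrow> ennreal ((norm (fourier (s k) u - 0))\<^sup>2)"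
          by (intro tendsto_intros)
        from lim_imp_Liminf[OF _ this]
        show "ennreal ((norm (fourier (s k) u))\<^sup>2) = liminf (\<lambda>j. ennreal ((norm (fourier (s k) u - fourier (s (r j)) u))\<^sup>2))"
          by simp
      qed
      also have "\<dots> \<le> liminf (\<lambda>j. ennreal (?q k (r j)))"
        unfolding q[symmetric] by (rule nn_integral_liminf) measurable
      also have "\<dots> \<le> ennreal (e / 2)"
      proof (rule Liminf_le)
        show "\<forall>\<^sub>F j in sequentially. ennreal (?q k (r j)) \<le> ennreal (e / 2)"
          unfolding eventually_sequentially
        proof (intro exI allI impI ennreal_leI)
          fix j assume "N \<le> j"
          then have "N \<le> r j" using seq_suble[OF r, of j] by simp
          from N[OF k this] show "?q k (r j) \<le> e / 2" by simp
        qed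
      qed simp
      finally have "spectral_form \<sigma> (s k) \<le> e / 2" using e by simp
      moreover have "0 \<le> spectral_form \<sigma> (s k)"
        by (simp add: spectral_form_def integral_nonneg_AE)
      ultimately show ?thesis using e by simp
    qed
    then show "\<exists>N. \<forall>k\<ge>N. norm (spectral_form \<sigma> (s k) - 0) < e" by blast
  qed
qed

text \<open>
  Inner regularity replaces a Lebesgue null set charged by \<open>\<sigma>\<close> by a compact one.
\<close>
lemma tempered_null_compact:
  fixes \<sigma> :: "(real^'n::finite) measure"
  assumes \<sigma>: "\<sigma> \<in> tempered_measures" and nac: "\<not> absolutely_continuous lborel \<sigma>"
  obtains K where "compact K" "emeasure lborel K = 0" "0 < emeasure \<sigma> K"
proof -
  obtain A where A: "A \<in> null_sets lborel" "A \<notin> null_sets \<sigma>"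
    using nac by (auto simp: absolutely_continuous_def)
  have Ab: "A \<in> sets borel" using A(1) by auto
  have "0 < emeasure \<sigma> A"
    using A(2) Ab tempered_measure_sets[OF \<sigma>] by (auto simp: null_sets_def zero_less_iff_neq_zero)
  also have "emeasure \<sigma> A = (SUP K\<in>{K. compact K \<and> K \<subseteq> A}. emeasure \<sigma> K)"
    using \<sigma> Ab unfolding tempered_measures_def regular_borel_measure_def by blast
  finally obtain K where K: "compact K" "K \<subseteq> A" "0 < emeasure \<sigma> K"
    by (auto simp: less_SUP_iff)
  have "K \<in> null_sets lborel"
    using null_sets_subset[OF A(1) _ K(2)] borel_compact[OF K(1)] by simp
  then show thesis using that K by auto
qed

text \<open>
  The witnesses have as Fourier transforms mollified tents around \<open>K\<close>, which converge pointwise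
  to the indicator of \<open>K\<close> under a common bound. Their \<open>L\<^sub>2\<close> norms tend to 0 because \<open>K\<close> is Lebesgue
  null, whereas their Fourier transforms converge in \<open>L\<^sub>2(\<sigma>)\<close> to the indicator of \<open>K\<close>, so the form tends to
  \<open>\<sigma> K > 0\<close> although the sequence is Cauchy for it.
\<close>
lemma not_closable_if_charges_null_compact:
  fixes \<sigma> :: "(real^'n::finite) measure"
  assumes \<sigma>: "\<sigma> \<in> tempered_measures"
    and K: "compact K" "emeasure lborel K = 0" "0 < emeasure \<sigma> K"
  shows "\<not> closable (spectral_form \<sigma>)"
proof
  assume closable: "closable (spectral_form \<sigma>)"
  note [measurable_cong] = tempered_measure_sets[OF \<sigma>]
  let ?I = "gaussian_mass TYPE('n)"
  have [measurable]: "K \<in> sets borel" using K(1) by (rule borel_compact)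
  have ind2: "(indicator K u :: real)\<^sup>2 = indicator K u" for u
    by (simp split: split_indicator)
  have ne: "K \<noteq> {}" using K(3) by auto
  obtain r where r: "\<And>x. x \<in> K \<Longrightarrow> norm x \<le> r"
    using compact_imp_bounded[OF K(1)] by (auto simp: bounded_iff)
  obtain p where p: "integrable \<sigma> (\<lambda>u. 1 / (1 + (norm u)\<^sup>2) ^ p)"
    using tempered_measureE[OF \<sigma>] .
  obtain C where C: "0 \<le> C" "\<forall>w \<epsilon> u. w \<in> borel_measurable borel \<longrightarrow> (\<forall>x. 0 \<le> w x \<and> w x \<le> 1)
      \<longrightarrow> (\<forall>x. r + 1 < norm x \<longrightarrow> w x = 0) \<longrightarrow> 0 < \<epsilon> \<longrightarrow> \<epsilon> \<le> 1
      \<longrightarrow> mollify \<epsilon> w (u :: real^'n) \<le> C * (1 / (1 + (norm u)\<^sup>2) ^ p)"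
    using mollify_le_weight[of "r + 1" p, where 'n='n] by blast
  \<comment> \<open>The tent has Lipschitz constant \<open>k + 1\<close>, so this scale makes the mollification error of order \<open>1 / (k + 1)\<close>.\<close>
  define \<epsilon> where "\<epsilon> k = 1 / (real (Suc k))\<^sup>2" for k
  have \<epsilon>: "0 < \<epsilon> k" "\<epsilon> k \<le> 1" for k
    by (auto simp: \<epsilon>_def divide_le_eq_1 one_le_power)
  define a where "a k = mollify (\<epsilon> k) (tent K k)" for k
  define s where "s k = mollify_preimage (\<epsilon> k) (tent K k)" for k
  note rt = tent_rapidly_decreasing[OF ne r]
  have sS: "s k \<in> schwartz_space" for k
    unfolding s_def using \<epsilon>[of k] by (intro mollify_preimage_schwartz rt) auto
  have Fs: "fourier (s k) = (\<lambda>u. complex_of_real (a k u))" for k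
    unfolding s_def a_def by (intro ext fourier_mollify_preimage rt \<epsilon>)
  have Fs_m: "fourier (s k) \<in> borel_measurable borel" for k
    using fourier_schwartz_rapidly_decreasing[OF sS[of k]] by measurable
  have [measurable]: "a k \<in> borel_measurable borel" for k
  proof -
    have "(\<lambda>u. Re (fourier (s k) u)) \<in> borel_measurable borel"
      using Fs_m[of k] by measurable
    then show ?thesis by (simp add: Fs)
  qed
  have a0: "0 \<le> a k u" for k u
    unfolding a_def by (intro mollify_nonneg tent_nonneg)
  \<comment> \<open>The common bound: \<open>C\<close> accounts for the mollified tents and the other summand for the indicator of \<open>K\<close>. As \<open>W\<close> is itself bounded, \<open>W\<^sup>2\<close> is at most a multiple of \<open>W\<close>.\<close>
  define W where "W u = (C + (1 + r\<^sup>2) ^ p) * (1 / (1 + (norm (u :: real^'n))\<^sup>2) ^ p)" for u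
  have W: "integrable \<sigma> W"
    unfolding W_def[abs_def] by (intro integrable_mult_right p)
  have aW: "a k u \<le> W u" for k u
  proof -
    have "a k u \<le> C * (1 / (1 + (norm u)\<^sup>2) ^ p)"
      unfolding a_def
      by (intro C(2)[rule_format] conjI tent_measurable tent_nonneg tent_le_1 tent_supported[OF ne r] \<epsilon>)
    also have "\<dots> \<le> W u"
      unfolding W_def by (intro mult_right_mono) auto
    finally show ?thesis .
  qed
  have W0: "0 \<le> W u" for u using aW[of 0 u] a0[of 0 u] by simp
  have KW: "indicator K u \<le> W u" for u :: "real^'n"
  proof (cases "u \<in> K")
    case True
    have "(1 + (norm u)\<^sup>2) ^ p \<le> (1 + r\<^sup>2) ^ p"
      using r[OF True] by (intro power_mono add_mono) auto
    also have "\<dots> \<le> C + (1 + r\<^sup>2) ^ p" using C(1) by simp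
    finally show ?thesis
      using True weight_denominator_pos[of u p] by (simp add: W_def)
  qed (use W0 in simp)
  have Wle: "W u \<le> C + (1 + r\<^sup>2) ^ p" for u
  proof -
    have "1 / (1 + (norm u)\<^sup>2) ^ p \<le> 1"
      using weight_denominator_pos[of u p] one_le_power[of "1 + (norm u)\<^sup>2" p] by simp
    then show ?thesis
      using mult_left_mono[of "1 / (1 + (norm u)\<^sup>2) ^ p" 1 "C + (1 + r\<^sup>2) ^ p"] C(1)
      unfolding W_def by simp
  qed
  let ?V = "\<lambda>u. (C + (1 + r\<^sup>2) ^ p) * W u"
  have V: "integrable \<sigma> ?V" by (intro integrable_mult_right W)
  have WV: "(W u)\<^sup>2 \<le> ?V u" for u
    unfolding power2_eq_square[of "W u"] by (intro mult_right_mono Wle W0)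
  have lim: "(\<lambda>k. a k u) \<longlonglongrightarrow> indicator K u" for u
  proof -
    define M where "M = (LINT z|lborel. norm (z :: real^'n) * gaussian z) / ?I"
    have "\<bar>a k u - tent K k u\<bar> \<le> M * (1 / real (Suc k))" for k
    proof -
      have "\<bar>a k u - tent K k u\<bar> \<le> real (Suc k) * \<epsilon> k * M"
        unfolding a_def M_def
        by (rule mollify_minus_le[OF tent_measurable tent_nonneg tent_le_1 tent_lipschitz \<epsilon>(1)])
      also have "real (Suc k) * \<epsilon> k = 1 / real (Suc k)"
        by (simp add: \<epsilon>_def power2_eq_square)
      finally show ?thesis by (simp add: mult.commute)
    qed
    then have ev: "\<forall>\<^sub>F k in sequentially. \<bar>a k u - tent K k u\<bar> \<le> M * (1 / real (Suc k))"
      by (intro always_eventually allI)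
    have "(\<lambda>k. 1 / real (Suc k)) \<longlonglongrightarrow> 0"
      by (rule LIMSEQ_Suc[OF lim_1_over_n])
    from tendsto_mult_left[OF this, of M]
    have t0: "(\<lambda>k. M * (1 / real (Suc k))) \<longlonglongrightarrow> 0"
      by (simp only: mult_zero_right)
    have "(\<lambda>k. \<bar>a k u - tent K k u\<bar>) \<longlonglongrightarrow> 0"
      by (rule tendsto_sandwich[OF _ ev tendsto_const t0]) simp
    then have "(\<lambda>k. a k u - tent K k u) \<longlonglongrightarrow> 0"
      by (rule tendsto_rabs_zero_cancel)
    from tendsto_add[OF this tent_tendsto_indicator[OF compact_imp_closed[OF K(1)] ne, of u]]
    show ?thesis by simp
  qed
  have int_a: "integrable \<sigma> (\<lambda>u. (a k u)\<^sup>2)" for k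
    using rapidly_decreasing_square_integrable_tempered[OF \<sigma> fourier_schwartz_rapidly_decreasing[OF sS[of k]]]
    by (simp add: Fs)
  have int_K: "integrable \<sigma> (indicator K :: _ \<Rightarrow> real)"
    by (rule Bochner_Integration.integrable_bound[OF W]) (use KW W0 in auto)
  define d where "d k = (LINT u|\<sigma>. (a k u - indicator K u)\<^sup>2)" for k
  have dW: "(a k u - indicator K u)\<^sup>2 \<le> ?V u" for k u
  proof -
    have "\<bar>a k u - indicator K u\<bar> \<le> W u"
      using aW[of k u] a0[of k u] KW[of u] by (auto simp: abs_le_iff split: split_indicator)
    then have "\<bar>a k u - indicator K u\<bar>\<^sup>2 \<le> (W u)\<^sup>2" by (intro power_mono) auto
    with WV[of u] show ?thesis by simp
  qed
  have d: "d \<longlonglongrightarrow> 0"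
  proof -
    have "d \<longlonglongrightarrow> (LINT u|\<sigma>. 0)"
      unfolding d_def[abs_def]
    proof (rule integral_dominated_convergence[OF _ _ V])
      show "AE u in \<sigma>. (\<lambda>k. (a k u - indicator K u)\<^sup>2) \<longlonglongrightarrow> 0"
      proof (rule AE_I2)
        fix u
        have "(\<lambda>k. (a k u - indicator K u)\<^sup>2) \<longlonglongrightarrow> (indicator K u - indicator K u)\<^sup>2"
          by (intro tendsto_power tendsto_diff lim tendsto_const)
        then show "(\<lambda>k. (a k u - indicator K u)\<^sup>2) \<longlonglongrightarrow> 0" by simp
      qed
    qed (use dW in auto)
    then show ?thesis by simp
  qed
  have int_d: "integrable \<sigma> (\<lambda>u. (a k u - indicator K u)\<^sup>2)" for k
    by (rule Bochner_Integration.integrable_bound[OF V]) (use dW in \<open>auto intro: order_trans[OF _ abs_ge_self]\<close>)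
  have q: "spectral_form \<sigma> (s k) = (LINT u|\<sigma>. (a k u)\<^sup>2)" for k
    by (simp add: spectral_form_def Fs)
  have q2: "spectral_form \<sigma> (\<lambda>x. s k x - s l x) = (LINT u|\<sigma>. (a k u - a l u)\<^sup>2)" for k l
  proof -
    have "fourier (\<lambda>x. s k x - s l x) u = complex_of_real (a k u - a l u)" for u
      using sS by (simp add: fourier_diff rapidly_decreasing_integrable schwartz_space_rapidly_decreasing Fs)
    then show ?thesis by (simp only: spectral_form_def norm_of_real power2_abs)
  qed
  have "(\<lambda>k. spectral_form \<sigma> (s k)) \<longlonglongrightarrow> 0"
  proof (rule closable[unfolded closable_def, rule_format, OF sS])
    have "(\<lambda>k. LINT x|lborel. (tent K k x)\<^sup>2) \<longlonglongrightarrow> (LINT x|lborel. (indicator K x :: real)\<^sup>2)"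
    proof (rule integral_dominated_convergence[where w = "indicator (cball 0 (r + 1))"])
      show "integrable lborel (indicator (cball (0::real^'n) (r + 1)) :: _ \<Rightarrow> real)"
        by (rule integrable_real_indicator) (use emeasure_bounded_finite[OF bounded_cball] in auto)
      show "AE x in lborel. (\<lambda>k. (tent K k x)\<^sup>2) \<longlonglongrightarrow> (indicator K x)\<^sup>2"
        by (intro AE_I2 tendsto_power tent_tendsto_indicator compact_imp_closed K ne)
      have "(tent K k x)\<^sup>2 \<le> indicator (cball 0 (r + 1)) x" for k x
        using tent_supported[OF ne r, of x k] power_le_one[OF tent_nonneg tent_le_1, of K k x 2]
        by (cases "x \<in> cball 0 (r + 1)") auto
      then show "AE x in lborel. norm ((tent K k x)\<^sup>2) \<le> indicator (cball 0 (r + 1)) x" for k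
        by simp
    qed auto
    also have "(LINT x|lborel. (indicator K x :: real)\<^sup>2) = 0"
      using K(2) by (simp add: ind2 measure_def)
    finally have "(\<lambda>k. sqrt ((LINT x|lborel. (tent K k x)\<^sup>2) / ?I\<^sup>2)) \<longlonglongrightarrow> sqrt (0 / ?I\<^sup>2)"
      using gaussian_mass_pos[where 'n='n] by (intro tendsto_intros) auto
    then have t0: "(\<lambda>k. sqrt ((LINT x|lborel. (tent K k x)\<^sup>2) / ?I\<^sup>2)) \<longlonglongrightarrow> 0" by simp
    show "(\<lambda>k. L2_norm (s k)) \<longlonglongrightarrow> 0"
    proof (rule tendsto_sandwich[OF _ _ tendsto_const t0])
      show "\<forall>\<^sub>F k in sequentially. 0 \<le> L2_norm (s k)"
        by (simp add: L2_norm_def integral_nonneg_AE)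
      show "\<forall>\<^sub>F k in sequentially. L2_norm (s k) \<le> sqrt ((LINT x|lborel. (tent K k x)\<^sup>2) / ?I\<^sup>2)"
        unfolding s_def by (intro always_eventually allI L2_norm_mollify_preimage_le rt \<epsilon>)
    qed
    show "((\<lambda>(k, l). spectral_form \<sigma> (\<lambda>x. s k x - s l x)) \<longlongrightarrow> 0) (sequentially \<times>\<^sub>F sequentially)"
    proof (rule tendsto_sandwich[OF _ _ tendsto_const])
      have "((\<lambda>z. 2 * d (fst z) + 2 * d (snd z)) \<longlongrightarrow> 2 * 0 + 2 * 0) (sequentially \<times>\<^sub>F sequentially)"
        by (intro tendsto_intros filterlim_compose[OF d] filterlim_fst filterlim_snd)
      then show "((\<lambda>z. 2 * d (fst z) + 2 * d (snd z)) \<longlongrightarrow> 0) (sequentially \<times>\<^sub>F sequentially)"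
        by simp
      have "(LINT u|\<sigma>. (a k u - a l u)\<^sup>2) \<le> 2 * d k + 2 * d l" for k l
      proof -
        have "(LINT u|\<sigma>. (a k u - a l u)\<^sup>2) \<le> (LINT u|\<sigma>. 2 * (a k u - indicator K u)\<^sup>2 + 2 * (a l u - indicator K u)\<^sup>2)"
        proof (rule integral_mono')
          show "integrable \<sigma> (\<lambda>u. 2 * (a k u - indicator K u)\<^sup>2 + 2 * (a l u - indicator K u)\<^sup>2)"
            by (intro Bochner_Integration.integrable_add integrable_mult_right int_d)
          fix u
          have "0 \<le> ((a k u - indicator K u) + (a l u - indicator K u))\<^sup>2" by simp
          then show "(a k u - a l u)\<^sup>2 \<le> 2 * (a k u - indicator K u)\<^sup>2 + 2 * (a l u - indicator K u)\<^sup>2"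
            by (simp add: power2_eq_square algebra_simps)
        qed auto
        also have "\<dots> = 2 * d k + 2 * d l"
          unfolding d_def using int_d by (subst Bochner_Integration.integral_add) auto
        finally show ?thesis .
      qed
      then show "\<forall>\<^sub>F z in sequentially \<times>\<^sub>F sequentially. (case z of (k, l) \<Rightarrow> spectral_form \<sigma> (\<lambda>x. s k x - s l x)) \<le> 2 * d (fst z) + 2 * d (snd z)"
        by (intro always_eventually) (auto simp: q2)
      show "\<forall>\<^sub>F z in sequentially \<times>\<^sub>F sequentially. 0 \<le> (case z of (k, l) \<Rightarrow> spectral_form \<sigma> (\<lambda>x. s k x - s l x))"
        by (intro always_eventually) (auto simp: q2 integral_nonneg_AE)
    qed
  qed
  moreover have "(\<lambda>k. spectral_form \<sigma> (s k)) \<longlonglongrightarrow> measure \<sigma> K"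
  proof -
    have "(\<lambda>k. LINT u|\<sigma>. (a k u)\<^sup>2) \<longlonglongrightarrow> (LINT u|\<sigma>. (indicator K u :: real)\<^sup>2)"
    proof (rule integral_dominated_convergence[OF _ _ V])
      show "AE u in \<sigma>. (\<lambda>k. (a k u)\<^sup>2) \<longlonglongrightarrow> (indicator K u)\<^sup>2"
        by (intro AE_I2 tendsto_power lim)
      have "(a k u)\<^sup>2 \<le> ?V u" for k u
        using power_mono[OF aW[of k u] a0[of k u], of 2] WV[of u] by simp
      then show "AE u in \<sigma>. norm ((a k u)\<^sup>2) \<le> ?V u" for k by simp
    qed auto
    also have "(LINT u|\<sigma>. (indicator K u :: real)\<^sup>2) = measure \<sigma> K"
      by (simp add: ind2 sets_eq_imp_space_eq[OF tempered_measure_sets[OF \<sigma>]])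
    finally show ?thesis by (simp add: q)
  qed
  ultimately have "measure \<sigma> K = 0"
    by (metis LIMSEQ_unique)
  moreover have "emeasure \<sigma> K < \<infinity>"
    using int_K by (subst (asm) integrable_indicator_iff) (auto simp: sets_eq_imp_space_eq[OF tempered_measure_sets[OF \<sigma>]])
  ultimately show False
    using K(3) by (auto simp: measure_def enn2real_eq_0_iff)
qed

theorem theorem4p2:
  fixes \<sigma> :: "(real ^ 'n::finite) measure"
  assumes "\<sigma> \<in> tempered_measures"
  shows "closable (spectral_form \<sigma>) \<longleftrightarrow> absolutely_continuous lborel \<sigma>"
  using closable_if_absolutely_continuous[OF assms] not_closable_if_charges_null_compact[OF assms]
    tempered_null_compact[OF assms] by metis

end
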